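(* Let $K$ be a complete non-Archimedean field and let $\iota\colon\mathbb P^r\hookrightarrow\mathbb P^n$ be a linear closed immersion over $K$. Then there is a natural piecewise linear embedding $J\colon\operatorname{Trop}(\mathbb P^r,\iota)\to\overline{\mathcal B}_r(K)$ such that $$\operatorname{trop}\circ\,\overline{\mathcal B}(\iota)\circ J\colon\operatorname{Trop}(\mathbb P^r,\iota)\to\mathbb T\mathbb P^n$$ is the inclusion $\operatorname{Trop}(\mathbb P^r,\iota)\subseteq\mathbb T\mathbb P^n$.
   Context: $K$ is a field complete with respect to a non-Archimedean absolute value $|\cdot|$ (possibly trivial), $\mathrm{val}=-\log|\cdot|$. A seminorm on a finite-dimensional $K$-vector space $W$ is a map $\|\cdot\|\colon W\to\mathbb R$ with $\|w\|\ge0$, $\|\lambda w\|=|\lambda|\,\|w\|$, $\|w+w'\|\le\max\{\|w\|,\|w'\|\}$; it is non-trivial if not identically $0$. For a basis $\mathbf e=(e_0,\dots,e_r)$ of $W$ and $\vec a\in\overline{\mathbb R}^{r+1}$, $\overline{\mathbb R}=\mathbb R\cup\{\infty\}$, put $\|\sum\lambda_ie_i\|_{\mathbf e,\vec a}=\max_i|\lambda_i|e^{-a_i}$; seminorms of this form are called diagonalizable. $\overline{\mathcal X}_r(K)$ is the set of non-trivial seminorms on $(K^{r+1})^*$ modulo homothety ($\|\cdot\|\sim c\|\cdot\|$, $c>0$), with the quotient of the topology of pointwise convergence; $\overline{\mathcal B}_r(K)\subseteq\overline{\mathcal X}_r(K)$ is the subspace of classes of diagonalizable seminorms. For a basis $\mathbf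 e$ of $(K^{r+1})^*$, the compactified apartment $\overline{\mathcal A}(\mathbf e)\subseteq\overline{\mathcal B}_r(K)$ is the set of classes of the $\|\cdot\|_{\mathbf e,\vec a}$, $\vec a\ne(\infty,\dots,\infty)$; via $\vec a$ it is identified with $\mathbb T\mathbb P^r$, where $\mathbb T\mathbb P^n=(\overline{\mathbb R}^{n+1}\setminus\{(\infty,\dots,\infty)\})/\mathbb R\cdot(1,\dots,1)$. Write $\iota=[f_0:\dots:f_n]$ with $f_0,\dots,f_n$ spanning $(K^{r+1})^*$; $\iota$ comes from the injective linear map $K^{r+1}\to K^{n+1}$, $z\mapsto(f_i(z))_i$. The map $\overline{\mathcal B}(\iota)\colon\overline{\mathcal B}_r(K)\to\overline{\mathcal B}_n(K)$ sends the class of $\|\cdot\|$ to the class of $g\mapsto\|g\circ\iota\|$, $g\in(K^{n+1})^*$. The map $\operatorname{trop}\colon\overline{\mathcal B}_n(K)\to\mathbb T\mathbb P^n$ sends the class of $\|\cdot\|$ to $[-\log\|e_0^*\|:\dots:-\log\|e_n^*\|]$, with $(e_i^* )$ the standard dual basis. $\operatorname{Trop}(\mathbb P^r,\iota)\subseteq\mathbb T\mathbb P^n$ is the image of $\iota(\mathbb P^r)^{\mathrm{an}}\subseteq(\mathbb P^n)^{\mathrm{an}}$ (Berkovich analytification) under $x\mapsto[-\log|t_0|_x:\dots:-\log|t_n|_x]$, $t_i$ the homogeneous coordinates. Polyhedral structure on $\operatorname{Trop}(\mathbb P^r,\iota)$: coordinates with $f_i=0$ are constantly $\infty$ and are disregarded.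 For $B=\{b_0,\dots,b_r\}\subseteq\{0,\dots,n\}$ let $v(B)=\mathrm{val}(\det[f_{b_0}\cdots f_{b_r}])$; for $u\in\operatorname{Trop}(\mathbb P^r,\iota)$ with finite coordinates let the initial matroid $M_u$ be the matroid whose bases are the $B$ minimizing $v(B)-\sum_{b\in B}u_b$. The (finitely many) cells are the closures of the sets of $u$ on which $M_u$ is constant. A piecewise linear embedding $J\colon\operatorname{Trop}(\mathbb P^r,\iota)\to\overline{\mathcal B}_r(K)$ is an embedding for which there is a finite covering of $\operatorname{Trop}(\mathbb P^r,\iota)$ by subcomplexes such that the image of each subcomplex lies in a (compactified) apartment and the restriction of $J$ to each subcomplex is piecewise linear. *)

theory Defs
  imports "HOL-Analysis.Analysis" "HOL-Library.Poly_Mapping"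
begin

text \<open>
  The field is a type of class \<open>field\<close> with an explicit absolute value \<open>nabs\<close>.
  \<open>K\<^sup>r\<^sup>+\<^sup>1\<close> is \<open>'k^'r\<close> for a finite index type \<open>'r\<close> with \<open>r + 1\<close> elements, so \<open>r \<ge> 0\<close> is
  arbitrary; likewise \<open>'n\<close> has \<open>n + 1\<close> elements.
\<close>

subsection \<open>Complete non-Archimedean fields\<close>

definition complete_nonarch_field :: "('k::field \<Rightarrow> real) \<Rightarrow> bool" where
  "complete_nonarch_field nabs \<longleftrightarrow>
     (\<forall>x. 0 \<le> nabs x) \<and> (\<forall>x. nabs x = 0 \<longleftrightarrow> x = 0) \<and>
     (\<forall>x y. nabs (x * y) = nabs x * nabs y) \<and>
     (\<forall>x y. nabs (x + y) \<le> max (nabs x) (nabs y)) \<and>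
     Metric_space.mcomplete UNIV (\<lambda>x y. nabs (x - y))"

text \<open>\<open>\<real> \<union> {\<infinity>}\<close> is modelled by the extended reals other than \<open>-\<infinity>\<close>.
  The next two functions are \<open>x \<mapsto> -log x\<close> on \<open>[0,\<infinity>)\<close> and its inverse \<open>a \<mapsto> e\<^sup>-\<^sup>a\<close>.\<close>

definition neglog :: "real \<Rightarrow> ereal" where
  "neglog x = (if x = 0 then \<infinity> else ereal (- ln x))"

definition expneg :: "ereal \<Rightarrow> real" where
  "expneg a = (if a = \<infinity> then 0 else exp (- real_of_ereal a))"


subsection \<open>Quotient topology\<close>

definition quotient_topology :: "'a topology \<Rightarrow> ('a \<times> 'a) set \<Rightarrow> 'a set topology" where
  "quotient_topology T R =
     topology (\<lambda>U. U \<subseteq> topspace T // R \<and> openin T {x \<in> topspace T. R `` {x} \<in> U})"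

lemma openin_quotient_topology:
  "openin (quotient_topology T R) U \<longleftrightarrow>
     U \<subseteq> topspace T // R \<and> openin T {x \<in> topspace T. R `` {x} \<in> U}"
proof -
  have "istopology (\<lambda>U. U \<subseteq> topspace T // R \<and> openin T {x \<in> topspace T. R `` {x} \<in> U})"
    unfolding istopology_def
  proof (intro conjI allI impI)
    fix S U
    assume a: "S \<subseteq> topspace T // R \<and> openin T {x \<in> topspace T. R `` {x} \<in> S}"
      and b: "U \<subseteq> topspace T // R \<and> openin T {x \<in> topspace T. R `` {x} \<in> U}"
    show "S \<inter> U \<subseteq> topspace T // R" using a by blast
    have "{x \<in> topspace T. R `` {x} \<in> S \<inter> U} =
        {x \<in> topspace T. R `` {x} \<in> S} \<inter> {x \<in> topspace T. R `` {x} \<in> U}" by blast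
    then show "openin T {x \<in> topspace T. R `` {x} \<in> S \<inter> U}" using a b by auto
  next
    fix \<K>
    assume a: "\<forall>S\<in>\<K>. S \<subseteq> topspace T // R \<and> openin T {x \<in> topspace T. R `` {x} \<in> S}"
    show "\<Union>\<K> \<subseteq> topspace T // R" using a by blast
    have "{x \<in> topspace T. R `` {x} \<in> \<Union>\<K>} =
        (\<Union>S\<in>\<K>. {x \<in> topspace T. R `` {x} \<in> S})" by blast
    then show "openin T {x \<in> topspace T. R `` {x} \<in> \<Union>\<K>}" using a by auto
  qed
  then show ?thesis unfolding quotient_topology_def by (simp add: topology_inverse')
qed


subsection \<open>Tropical projective space\<close>

definition trop_cone :: "('n::finite \<Rightarrow> ereal) set" where
  "trop_cone = {u. (\<forall>i. u i \<noteq> -\<infinity>) \<and> (\<exists>i. u i \<noteq> \<infinity>)}"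

definition trop_rel :: "(('n::finite \<Rightarrow> ereal) \<times> ('n \<Rightarrow> ereal)) set" where
  "trop_rel = {(u, v). u \<in> trop_cone \<and> v \<in> trop_cone \<and> (\<exists>c::real. \<forall>i. v i = u i + ereal c)}"

definition TP_topology :: "('n::finite \<Rightarrow> ereal) set topology" where
  "TP_topology =
     quotient_topology (subtopology (product_topology (\<lambda>_. euclidean) UNIV) trop_cone) trop_rel"


subsection \<open>The compactified Goldman--Iwahori space and building\<close>

text \<open>
  A linear form on \<open>'k^'m\<close> is given by its coefficient vector with respect to the standard dual
  basis, so the dual space is again \<open>'k^'m\<close>, with the evaluation pairing \<open>lform\<close>.
\<close>

definition lform :: "'k::field^'m::finite \<Rightarrow> 'k^'m \<Rightarrow> 'k" where
  "lform g z = (\<Sum>i\<in>UNIV. g $ i * z $ i)"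

definition seminorm :: "('k::field \<Rightarrow> real) \<Rightarrow> ('k^'m::finite \<Rightarrow> real) \<Rightarrow> bool" where
  "seminorm nabs s \<longleftrightarrow>
     (\<forall>w. 0 \<le> s w) \<and> (\<forall>c w. s (c *s w) = nabs c * s w) \<and>
     (\<forall>w w'. s (w + w') \<le> max (s w) (s w'))"

definition nontrivial_seminorms :: "('k::field \<Rightarrow> real) \<Rightarrow> ('k^'m::finite \<Rightarrow> real) set" where
  "nontrivial_seminorms nabs = {s. seminorm nabs s \<and> (\<exists>w. s w \<noteq> 0)}"

definition homothety ::
  "('k::field \<Rightarrow> real) \<Rightarrow> (('k^'m::finite \<Rightarrow> real) \<times> ('k^'m \<Rightarrow> real)) set" where
  "homothety nabs = {(s, t). s \<in> nontrivial_seminorms nabs \<and> t \<in> nontrivial_seminorms nabs \<and>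
     (\<exists>c>0. \<forall>w. t w = c * s w)}"

definition GI_topology :: "('k::field \<Rightarrow> real) \<Rightarrow> ('k^'m::finite \<Rightarrow> real) set topology" where
  "GI_topology nabs = quotient_topology
     (subtopology (product_topology (\<lambda>_. euclideanreal) UNIV) (nontrivial_seminorms nabs))
     (homothety nabs)"

definition is_basis :: "('m::finite \<Rightarrow> 'k::field^'m) \<Rightarrow> bool" where
  "is_basis e \<longleftrightarrow> inj e \<and> vec.independent (range e) \<and> vec.span (range e) = UNIV"

definition diag_seminorm ::
  "('k::field \<Rightarrow> real) \<Rightarrow> ('m::finite \<Rightarrow> 'k^'m) \<Rightarrow> ('m \<Rightarrow> ereal) \<Rightarrow> 'k^'m \<Rightarrow> real" where
  "diag_seminorm nabs e a w =
     Max (range (\<lambda>i. nabs (vec.representation (range e) w (e i)) * expneg (a i)))"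

definition diag_class ::
  "('k::field \<Rightarrow> real) \<Rightarrow> ('m::finite \<Rightarrow> 'k^'m) \<Rightarrow> ('m \<Rightarrow> ereal) \<Rightarrow> ('k^'m \<Rightarrow> real) set" where
  "diag_class nabs e a = homothety nabs `` {diag_seminorm nabs e a}"

definition apartment ::
  "('k::field \<Rightarrow> real) \<Rightarrow> ('m::finite \<Rightarrow> 'k^'m) \<Rightarrow> ('k^'m \<Rightarrow> real) set set" where
  "apartment nabs e = diag_class nabs e ` trop_cone"

definition building :: "('k::field \<Rightarrow> real) \<Rightarrow> ('k^'m::finite \<Rightarrow> real) set set" where
  "building nabs = (\<Union>e\<in>{e. is_basis e}. apartment nabs e)"

definition building_topology :: "('k::field \<Rightarrow> real) \<Rightarrow> ('k^'m::finite \<Rightarrow> real) set topology" where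
  "building_topology nabs = subtopology (GI_topology nabs) (building nabs)"


subsection \<open>Linear closed immersions\<close>

text \<open>
  \<open>\<iota> = [f\<^sub>0 : \<dots> : f\<^sub>n]\<close> is given by the family \<open>f\<close> of linear forms.
\<close>

definition linear_immersion :: "('n::finite \<Rightarrow> 'k::field^'r::finite) \<Rightarrow> bool" where
  "linear_immersion f \<longleftrightarrow> vec.span (range f) = UNIV"

definition imm_map :: "('n::finite \<Rightarrow> 'k::field^'r::finite) \<Rightarrow> 'k^'r \<Rightarrow> 'k^'n" where
  "imm_map f z = (\<chi> i. lform (f i) z)"

text \<open>The linear form \<open>g \<circ> \<iota>\<close>; compare \<open>lform_pull_form\<close>.\<close>

definition pull_form :: "('n::finite \<Rightarrow> 'k::field^'r::finite) \<Rightarrow> 'k^'n \<Rightarrow> 'k^'r" where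
  "pull_form f g = (\<Sum>i\<in>UNIV. g $ i *s f i)"

lemma lform_pull_form: "lform (pull_form f g) z = lform g (imm_map f z)"
proof -
  have "lform (pull_form f g) z = (\<Sum>j\<in>UNIV. \<Sum>i\<in>UNIV. g $ i * f i $ j * z $ j)"
    by (simp add: lform_def pull_form_def sum_distrib_right)
  also have "\<dots> = (\<Sum>i\<in>UNIV. \<Sum>j\<in>UNIV. g $ i * f i $ j * z $ j)"
    by (rule sum.swap)
  also have "\<dots> = lform g (imm_map f z)"
    by (simp add: lform_def imm_map_def sum_distrib_left mult.assoc)
  finally show ?thesis .
qed

text \<open>
  Maps out of quotients are written as unions of the (equal) classes obtained from all
  representatives.
\<close>

definition building_map :: "('k::field \<Rightarrow> real) \<Rightarrow> ('n::finite \<Rightarrow> 'k^'r::finite) \<Rightarrow>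
    ('k^'r \<Rightarrow> real) set \<Rightarrow> ('k^'n \<Rightarrow> real) set" where
  "building_map nabs f C = (\<Union>s\<in>C. homothety nabs `` {\<lambda>g. s (pull_form f g)})"

definition trop_map :: "('k::field^'n::finite \<Rightarrow> real) set \<Rightarrow> ('n \<Rightarrow> ereal) set" where
  "trop_map C = (\<Union>s\<in>C. trop_rel `` {\<lambda>i. neglog (s (axis i 1))})"


subsection \<open>Berkovich projective space and tropicalization\<close>

type_synonym ('n, 'k) mpol = "('n \<Rightarrow>\<^sub>0 nat) \<Rightarrow>\<^sub>0 'k"

definition const_mpol :: "'k::field \<Rightarrow> ('n::finite, 'k) mpol" where
  "const_mpol c = Poly_Mapping.single 0 c"

definition var_mpol :: "'n::finite \<Rightarrow> ('n, 'k::field) mpol" where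
  "var_mpol i = Poly_Mapping.single (Poly_Mapping.single i 1) 1"

definition homogeneous :: "nat \<Rightarrow> ('n::finite, 'k::field) mpol \<Rightarrow> bool" where
  "homogeneous d p \<longleftrightarrow> (\<forall>m\<in>Poly_Mapping.keys p. (\<Sum>i\<in>UNIV. Poly_Mapping.lookup m i) = d)"

text \<open>
  Points of the analytification of projective \<open>n\<close>-space in homogeneous coordinates: multiplicative seminorms on
  \<open>K[t\<^sub>0,\<dots>,t\<^sub>n]\<close> extending the absolute value of \<open>K\<close> and not vanishing on all \<open>t\<^sub>i\<close>; two of
  them are the same point iff there is \<open>C > 0\<close> such that they differ by the factor \<open>C\<^sup>d\<close> on
  homogeneous polynomials of degree \<open>d\<close>, for every \<open>d\<close>.
\<close>

definition an_cone :: "('k::field \<Rightarrow> real) \<Rightarrow> (('n::finite, 'k) mpol \<Rightarrow> real) set" where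
  "an_cone nabs = {x. (\<forall>p. 0 \<le> x p) \<and> (\<forall>p q. x (p * q) = x p * x q) \<and>
     (\<forall>p q. x (p + q) \<le> max (x p) (x q)) \<and> (\<forall>c. x (const_mpol c) = nabs c) \<and>
     (\<exists>i. x (var_mpol i) \<noteq> 0)}"

definition an_rel ::
  "('k::field \<Rightarrow> real) \<Rightarrow> ((('n::finite, 'k) mpol \<Rightarrow> real) \<times> (('n, 'k) mpol \<Rightarrow> real)) set" where
  "an_rel nabs = {(x, y). x \<in> an_cone nabs \<and> y \<in> an_cone nabs \<and>
     (\<exists>C>0. \<forall>d p. homogeneous d p \<longrightarrow> y p = C ^ d * x p)}"

definition proj_an :: "('k::field \<Rightarrow> real) \<Rightarrow> (('n::finite, 'k) mpol \<Rightarrow> real) set set" where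
  "proj_an nabs = an_cone nabs // an_rel nabs"

text \<open>The \<open>K\<close>-algebra homomorphism \<open>t\<^sub>i \<mapsto> f\<^sub>i\<close> from \<open>K[t\<^sub>0,\<dots>,t\<^sub>n]\<close> to \<open>K[z\<^sub>0,\<dots>,z\<^sub>r]\<close>. Its kernel
  is the homogeneous ideal of the image of \<open>\<iota>\<close>.\<close>

definition form_mpol :: "'k::field^'r::finite \<Rightarrow> ('r, 'k) mpol" where
  "form_mpol g = (\<Sum>j\<in>UNIV. const_mpol (g $ j) * var_mpol j)"

definition imm_comorphism ::
  "('n::finite \<Rightarrow> 'k::field^'r::finite) \<Rightarrow> ('n, 'k) mpol \<Rightarrow> ('r, 'k) mpol" where
  "imm_comorphism f p = (\<Sum>m\<in>Poly_Mapping.keys p. const_mpol (Poly_Mapping.lookup p m) *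
     (\<Prod>i\<in>UNIV. form_mpol (f i) ^ Poly_Mapping.lookup m i))"

definition imm_an ::
  "('k::field \<Rightarrow> real) \<Rightarrow> ('n::finite \<Rightarrow> 'k^'r::finite) \<Rightarrow> (('n, 'k) mpol \<Rightarrow> real) set set" where
  "imm_an nabs f = {X \<in> proj_an nabs. \<forall>x\<in>X. \<forall>p. imm_comorphism f p = 0 \<longrightarrow> x p = 0}"

definition trop_an :: "(('n::finite, 'k::field) mpol \<Rightarrow> real) set \<Rightarrow> ('n \<Rightarrow> ereal) set" where
  "trop_an X = (\<Union>x\<in>X. trop_rel `` {\<lambda>i. neglog (x (var_mpol i))})"

definition Trop ::
  "('k::field \<Rightarrow> real) \<Rightarrow> ('n::finite \<Rightarrow> 'k^'r::finite) \<Rightarrow> ('n \<Rightarrow> ereal) set set" where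
  "Trop nabs f = trop_an ` imm_an nabs f"

definition Trop_topology ::
  "('k::field \<Rightarrow> real) \<Rightarrow> ('n::finite \<Rightarrow> 'k^'r::finite) \<Rightarrow> ('n \<Rightarrow> ereal) set topology" where
  "Trop_topology nabs f = subtopology TP_topology (Trop nabs f)"


subsection \<open>The polyhedral structure\<close>

text \<open>Coordinates \<open>i\<close> with \<open>f i = 0\<close> are disregarded: they are not required to be finite, and
  the sets \<open>B\<close> below avoid them.\<close>

definition finite_lift :: "('n::finite \<Rightarrow> 'k::field^'r::finite) \<Rightarrow> ('n \<Rightarrow> ereal) \<Rightarrow> bool" where
  "finite_lift f u \<longleftrightarrow> u \<in> trop_cone \<and> (\<forall>i. u i = \<infinity> \<longleftrightarrow> f i = 0)"

definition candidate_bases :: "('n::finite \<Rightarrow> 'k::field^'r::finite) \<Rightarrow> 'n set set" where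
  "candidate_bases f = {B. card B = CARD('r) \<and> (\<forall>b\<in>B. f b \<noteq> 0)}"

text \<open>The value does not depend on the enumeration of \<open>B\<close>, which only affects the sign of the
  determinant.\<close>

definition det_val :: "('k::field \<Rightarrow> real) \<Rightarrow> ('n::finite \<Rightarrow> 'k^'r::finite) \<Rightarrow> 'n set \<Rightarrow> ereal" where
  "det_val nabs f B =
     (let \<sigma> = (SOME \<sigma>. bij_betw \<sigma> (UNIV :: 'r set) B)
      in neglog (nabs (det (\<chi> i j. f (\<sigma> j) $ i))))"

text \<open>The initial matroid, as its set of bases.\<close>

definition initial_matroid ::
  "('k::field \<Rightarrow> real) \<Rightarrow> ('n::finite \<Rightarrow> 'k^'r::finite) \<Rightarrow> ('n \<Rightarrow> ereal) \<Rightarrow> 'n set set" where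
  "initial_matroid nabs f u = {B \<in> candidate_bases f. \<forall>B'\<in>candidate_bases f.
     det_val nabs f B - (\<Sum>b\<in>B. u b) \<le> det_val nabs f B' - (\<Sum>b\<in>B'. u b)}"

definition open_cell :: "('k::field \<Rightarrow> real) \<Rightarrow> ('n::finite \<Rightarrow> 'k^'r::finite) \<Rightarrow>
    'n set set \<Rightarrow> ('n \<Rightarrow> ereal) set set" where
  "open_cell nabs f M = {trop_rel `` {u} |u. finite_lift f u \<and> trop_rel `` {u} \<in> Trop nabs f \<and>
     initial_matroid nabs f u = M}"

definition cells ::
  "('k::field \<Rightarrow> real) \<Rightarrow> ('n::finite \<Rightarrow> 'k^'r::finite) \<Rightarrow> ('n \<Rightarrow> ereal) set set set" where
  "cells nabs f = {Trop_topology nabs f closure_of open_cell nabs f M |M. open_cell nabs f M \<noteq> {}}"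

definition is_subcomplex :: "('k::field \<Rightarrow> real) \<Rightarrow> ('n::finite \<Rightarrow> 'k^'r::finite) \<Rightarrow>
    ('n \<Rightarrow> ereal) set set set \<Rightarrow> bool" where
  "is_subcomplex nabs f \<C> \<longleftrightarrow> \<C> \<subseteq> cells nabs f \<and> (\<forall>C\<in>\<C>. \<forall>D\<in>cells nabs f. D \<subseteq> C \<longrightarrow> D \<in> \<C>)"


subsection \<open>Piecewise linear embeddings\<close>

text \<open>The real vector of the finite coordinates of \<open>u\<close>; disregarded coordinates are set to \<open>0\<close>.\<close>

definition real_part :: "('n::finite \<Rightarrow> ereal) \<Rightarrow> real^'n" where
  "real_part u = (\<chi> i. real_of_ereal (u i))"

definition finite_support ::
  "('n::finite \<Rightarrow> 'k::field^'r::finite) \<Rightarrow> ('n \<Rightarrow> ereal) set set \<Rightarrow> (real^'n) set" where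
  "finite_support f S = {real_part u |u. finite_lift f u \<and> trop_rel `` {u} \<in> S}"

text \<open>
  \<open>J\<close> is piecewise linear on \<open>S\<close> with respect to the identification of \<open>apartment nabs e\<close> with
  tropical projective space: the finite part of \<open>S\<close> is a finite union of polyhedra on each of
  which \<open>J\<close> is, in homogeneous coordinates, an affine-linear map \<open>x \<mapsto> A x + b\<close>. On a union of
  cells, a continuous \<open>J\<close> is determined by this at the points with infinite coordinates, since
  every cell is the closure of its finite part.
\<close>

definition piecewise_linear_on :: "('k::field \<Rightarrow> real) \<Rightarrow> ('n::finite \<Rightarrow> 'k^'r::finite) \<Rightarrow>
    ('r \<Rightarrow> 'k^'r) \<Rightarrow> ('n \<Rightarrow> ereal) set set \<Rightarrow> (('n \<Rightarrow> ereal) set \<Rightarrow> ('k^'r \<Rightarrow> real) set) \<Rightarrow> bool" where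
  "piecewise_linear_on nabs f e S J \<longleftrightarrow>
     (\<exists>\<P>. finite \<P> \<and> (\<forall>P\<in>\<P>. polyhedron P) \<and> finite_support f S = \<Union>\<P> \<and>
        (\<forall>P\<in>\<P>. \<exists>(A :: real^'n^'r) b. \<forall>u. finite_lift f u \<longrightarrow> real_part u \<in> P \<longrightarrow>
           J (trop_rel `` {u}) = diag_class nabs e (\<lambda>i. ereal ((A *v real_part u + b) $ i))))"

definition piecewise_linear_embedding :: "('k::field \<Rightarrow> real) \<Rightarrow> ('n::finite \<Rightarrow> 'k^'r::finite) \<Rightarrow>
    (('n \<Rightarrow> ereal) set \<Rightarrow> ('k^'r \<Rightarrow> real) set) \<Rightarrow> bool" where
  "piecewise_linear_embedding nabs f J \<longleftrightarrow>
     embedding_map (Trop_topology nabs f) (building_topology nabs) J \<and>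
     (\<exists>\<S>. finite \<S> \<and> (\<forall>\<C>\<in>\<S>. is_subcomplex nabs f \<C>) \<and> (\<Union>\<C>\<in>\<S>. \<Union>\<C>) = Trop nabs f \<and>
        (\<forall>\<C>\<in>\<S>. \<exists>e. is_basis e \<and> J ` \<Union>\<C> \<subseteq> apartment nabs e \<and>
           piecewise_linear_on nabs f e (\<Union>\<C>) J))"

end

theory Submission
  imports Defs
begin

text \<open>
  For homogeneous coordinates \<open>u\<close> of a point of the tropicalization, let \<open>J\<close> assign to it the class
  of the largest seminorm \<open>s\<close> on the linear forms with \<open>s (f i) \<le> expneg (u i)\<close> for all \<open>i\<close>. The whole
  proof rests on the fact that this seminorm is diagonalized by a basis \<open>f \<circ> \<sigma>\<close> chosen among the
  forms \<open>f i\<close> and that it has the values \<open>expneg (u i)\<close>.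

  A point of the analytification of the image of \<open>\<iota>\<close> restricts to a seminorm on linear forms
  (\<open>Trop_imp_seminorm\<close>), so \<open>u\<close> consists of the values of \<open>- log s\<close> at the \<open>f i\<close> for some
  seminorm \<open>s\<close>. Assume first that \<open>u i\<close> is finite whenever \<open>f i \<noteq> 0\<close>, and let \<open>\<sigma>\<close> enumerate a basis of the initial
  matroid. Exchanging one element of the basis for \<open>f i\<close> cannot decrease
  \<open>v(B) - (\<Sum>b\<in>B. u b)\<close>; by Cramer's rule the determinant changes by the factor of a coordinate
  \<open>c\<close> of \<open>f i\<close>, and one reads off \<open>|c| s (f (\<sigma> k)) \<le> s (f i)\<close>. Hence the diagonal
  seminorm with the weights \<open>u \<circ> \<sigma>\<close> has the values \<open>expneg (u i)\<close> at all \<open>f i\<close>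
  (\<open>initial_matroid_imp_chart\<close>). The points for which this holds form the closed set \<open>chart \<sigma>\<close>; since
  norms are dense among seminorms and there are finitely many charts, they also cover the points with
  infinite coordinates (\<open>trop_lift_in_some_chart\<close>).

  On the image of a chart, \<open>J\<close> is \<open>u \<mapsto> [diag_seminorm nabs (f \<circ> \<sigma>) (u \<circ> \<sigma>)]\<close>, a coordinate
  projection into one apartment. By maximality the seminorms of two charts agree on their overlap, so
  \<open>J\<close> is well defined, and it is continuous by pasting. Conversely every diagonalizable seminorm
  extends to a multiplicative seminorm on polynomials, a Gauss norm, so \<open>trop \<circ> B(\<iota>)\<close> retracts the
  building continuously onto the tropicalization (\<open>diag_seminorm_in_Trop\<close>); \<open>J\<close> is a section of this
  retraction, hence an embedding.

  For the polyhedral structure, the ultrametric Hadamard inequality yields the converse of the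
  exchange argument: for finite \<open>u\<close> in \<open>chart \<sigma>\<close> the range of \<open>\<sigma>\<close> is a basis of the initial matroid
  (\<open>chart_imp_initial_matroid\<close>). So the finite part of a chart is a union of open cells, the cells
  inside the chart form a subcomplex that exhausts it (\<open>Union_chart_complex\<close>), and its finite part is
  cut out by the equations \<open>u i = min\<^sub>j (val c\<^sub>i\<^sub>j + u (\<sigma> j))\<close>, that is, it is a finite union of
  polyhedra.
\<close>

section \<open>Non-Archimedean absolute values\<close>

locale nonarch =
  fixes nabs :: "'k::field \<Rightarrow> real"
  assumes nabs_nonneg: "0 \<le> nabs x"
    and nabs_eq_0_iff [simp]: "nabs x = 0 \<longleftrightarrow> x = 0"
    and nabs_mult: "nabs (x * y) = nabs x * nabs y"
    and nabs_add_le: "nabs (x + y) \<le> max (nabs x) (nabs y)"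
begin

lemma nabs_0 [simp]: "nabs 0 = 0"
  by simp

lemma nabs_one [simp]: "nabs 1 = 1"
  using nabs_mult[of 1 1] by simp

lemma nabs_minus_one: "nabs (-1) = 1"
proof -
  have "nabs (-1) * nabs (-1) = 1"
    by (simp flip: nabs_mult)
  then show ?thesis
    using nabs_nonneg[of "-1"] by (metis abs_of_nonneg abs_square_eq_1 power2_eq_square)
qed

lemma nabs_minus [simp]: "nabs (- x) = nabs x"
  using nabs_mult[of "-1" x] by (simp add: nabs_minus_one)

lemma nabs_prod: "nabs (prod g A) = (\<Prod>i\<in>A. nabs (g i))"
  by (induction A rule: infinite_finite_induct) (auto simp: nabs_mult)

lemma nabs_sum_le:
  assumes "0 \<le> c" "\<And>i. i \<in> A \<Longrightarrow> nabs (g i) \<le> c"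
  shows "nabs (sum g A) \<le> c"
  using assms
proof (induction A rule: infinite_finite_induct)
  case (insert x F)
  then show ?case
    using nabs_add_le[of "g x" "sum g F"] by force
qed auto

lemma nabs_add_dominant:
  assumes "nabs y < nabs x"
  shows "nabs (x + y) = nabs x"
proof (rule antisym)
  show "nabs (x + y) \<le> nabs x"
    using nabs_add_le[of x y] assms by simp
  show "nabs x \<le> nabs (x + y)"
    using nabs_add_le[of "x + y" "- y"] assms by (auto simp: max_def split: if_splits)
qed

end

lemma nonarch_if_complete_nonarch_field:
  "complete_nonarch_field nabs \<Longrightarrow> nonarch nabs"
  by (simp add: complete_nonarch_field_def nonarch_def)


section \<open>The order-reversing bijection between weights and sizes\<close>

lemma expneg_nonneg [simp]: "0 \<le> expneg a"
  by (simp add: expneg_def)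

lemma expneg_infty [simp]: "expneg \<infinity> = 0"
  by (simp add: expneg_def)

lemma expneg_ereal [simp]: "expneg (ereal x) = exp (- x)"
  by (simp add: expneg_def)

lemma expneg_eq_0_iff [simp]: "expneg a = 0 \<longleftrightarrow> a = \<infinity>"
  by (simp add: expneg_def)

lemma neglog_0 [simp]: "neglog 0 = \<infinity>"
  by (simp add: neglog_def)

lemma neglog_neq_MInf [simp]: "neglog x \<noteq> -\<infinity>"
  by (simp add: neglog_def)

lemma neglog_eq_infty_iff [simp]: "neglog x = \<infinity> \<longleftrightarrow> x = 0"
  by (simp add: neglog_def)

lemma expneg_neglog [simp]: "0 \<le> x \<Longrightarrow> expneg (neglog x) = x"
  by (simp add: neglog_def expneg_def)

lemma neglog_expneg [simp]: "a \<noteq> -\<infinity> \<Longrightarrow> neglog (expneg a) = a"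
  by (cases a) (simp_all add: neglog_def)

lemma expneg_less_iff:
  assumes "a \<noteq> -\<infinity>" "b \<noteq> -\<infinity>"
  shows "expneg a < expneg b \<longleftrightarrow> b < a"
  using assms by (cases a; cases b) auto

lemma neglog_less_iff:
  assumes "0 \<le> x" "0 \<le> y"
  shows "neglog x < neglog y \<longleftrightarrow> y < x"
  using assms expneg_less_iff[of "neglog y" "neglog x"] by simp

lemma expneg_shift: "a \<noteq> -\<infinity> \<Longrightarrow> expneg (a + ereal c) = exp (- c) * expneg a"
  by (cases a) (simp_all add: exp_add[symmetric] expneg_def)

lemma neglog_mult:
  assumes "0 < c" "0 \<le> x"
  shows "neglog (c * x) = neglog x + ereal (- ln c)"
  using assms by (simp add: neglog_def ln_mult)

text \<open>
  Both maps reverse the order and are inverse to each other, so they exchange the open rays that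
  generate the two topologies.
\<close>

lemma continuous_on_expneg: "continuous_on {a. a \<noteq> -\<infinity>} expneg"
  unfolding continuous_on_def
proof (intro ballI order_tendstoI)
  fix a :: ereal and y :: real
  assume a: "a \<in> {a. a \<noteq> -\<infinity>}"
  let ?F = "at a within {a. a \<noteq> -\<infinity>}"
  { assume y: "y < expneg a"
    show "\<forall>\<^sub>F z in ?F. y < expneg z"
    proof (cases "0 \<le> y")
      case True
      then have "a < neglog y"
        using a y expneg_less_iff[of "neglog y" a] by simp
      then have "\<forall>\<^sub>F z in ?F. z < neglog y"
        by (intro order_tendstoD(2)[OF tendsto_ident_at])
      moreover have "\<forall>\<^sub>F z in ?F. z \<noteq> -\<infinity>"
        by (simp add: eventually_at_topological) blast
      ultimately show ?thesis
        by eventually_elim (use True expneg_less_iff[of "neglog y"] in simp)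
    next
      case False
      then show ?thesis
        by (intro always_eventually) (smt (verit) expneg_nonneg)
    qed }
  { assume y: "expneg a < y"
    then have pos: "0 < y"
      by (smt (verit) expneg_nonneg)
    then have "neglog y < a"
      using a y expneg_less_iff[of a "neglog y"] by simp
    then have "\<forall>\<^sub>F z in ?F. neglog y < z"
      by (intro order_tendstoD(1)[OF tendsto_ident_at])
    moreover have "\<forall>\<^sub>F z in ?F. z \<noteq> -\<infinity>"
      by (simp add: eventually_at_topological) blast
    ultimately show "\<forall>\<^sub>F z in ?F. expneg z < y"
      by eventually_elim (use pos expneg_less_iff[of _ "neglog y"] in simp) }
qed

lemma continuous_on_neglog: "continuous_on {0..} neglog"
  unfolding continuous_on_def
proof (intro ballI order_tendstoI)
  fix x :: real and b :: ereal
  assume x: "x \<in> {0..}"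
  let ?F = "at x within {0..}"
  have nonneg: "\<forall>\<^sub>F z in ?F. 0 \<le> z"
    by (simp add: eventually_at_topological) blast
  { assume b: "b < neglog x"
    show "\<forall>\<^sub>F z in ?F. b < neglog z"
    proof (cases "b = -\<infinity>")
      case False
      then have "x < expneg b"
        using b x neglog_less_iff[of "expneg b" x] by simp
      then have "\<forall>\<^sub>F z in ?F. z < expneg b"
        by (intro order_tendstoD(2)[OF tendsto_ident_at])
      with nonneg show ?thesis
        by eventually_elim (use False neglog_less_iff[of "expneg b"] in simp)
    qed simp }
  { assume b: "neglog x < b"
    then have "b \<noteq> -\<infinity>"
      by auto
    then have "expneg b < x"
      using b x neglog_less_iff[of x "expneg b"] by simp
    then have "\<forall>\<^sub>F z in ?F. expneg b < z"
      by (intro order_tendstoD(1)[OF tendsto_ident_at])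
    with nonneg show "\<forall>\<^sub>F z in ?F. neglog z < b"
      by eventually_elim (use \<open>b \<noteq> -\<infinity>\<close> neglog_less_iff[of _ "expneg b"] in simp) }
qed


section \<open>Coordinates and diagonalizable seminorms\<close>

abbreviation coord :: "('m::finite \<Rightarrow> 'k::field^'m) \<Rightarrow> 'k^'m \<Rightarrow> 'm \<Rightarrow> 'k" where
  "coord e w j \<equiv> vec.representation (range e) w (e j)"

lemma sum_coord:
  assumes "is_basis e"
  shows "(\<Sum>j\<in>UNIV. coord e w j *s e j) = w"
proof -
  have "(\<Sum>j\<in>UNIV. coord e w j *s e j) = (\<Sum>b\<in>range e. vec.representation (range e) w b *s b)"
    using assms by (simp add: is_basis_def sum.reindex)
  also have "\<dots> = w"
    using assms by (intro vec.sum_representation_eq) (auto simp: is_basis_def)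
  finally show ?thesis .
qed

lemma coord_basis:
  assumes "is_basis e"
  shows "coord e (e k) j = (if j = k then 1 else 0)"
  using assms by (auto simp: is_basis_def vec.representation_basis inj_eq)

lemma coord_add:
  "is_basis e \<Longrightarrow> coord e (v + w) j = coord e v j + coord e w j"
  by (simp add: is_basis_def vec.representation_add)

lemma coord_scale:
  "is_basis e \<Longrightarrow> coord e (c *s w) j = c * coord e w j"
  by (simp add: is_basis_def vec.representation_scale)

lemma basis_nonzero: "is_basis e \<Longrightarrow> e j \<noteq> 0"
  by (metis is_basis_def rangeI vec.dependent_zero)

lemma exists_coord_nonzero:
  assumes "is_basis e" "w \<noteq> 0"
  obtains j where "coord e w j \<noteq> 0"
  using sum_coord[OF assms(1), of w] assms(2) by force


lemma le_diag_seminorm: "nabs (coord e w j) * expneg (a j) \<le> diag_seminorm nabs e a w"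
  unfolding diag_seminorm_def by (intro Max_ge) auto

lemma diag_seminorm_le_iff:
  "diag_seminorm nabs e a w \<le> c \<longleftrightarrow> (\<forall>j. nabs (coord e w j) * expneg (a j) \<le> c)"
  unfolding diag_seminorm_def by (subst Max_le_iff) auto

lemma diag_seminorm_attained:
  obtains j where "diag_seminorm nabs e a w = nabs (coord e w j) * expneg (a j)"
proof -
  have "diag_seminorm nabs e a w \<in> range (\<lambda>j. nabs (coord e w j) * expneg (a j))"
    unfolding diag_seminorm_def by (intro Max_in) auto
  then show ?thesis
    using that by auto
qed

lemma diag_seminorm_shift:
  assumes "\<And>j. a j \<noteq> -\<infinity>"
  shows "diag_seminorm nabs e (\<lambda>j. a j + ereal c) w = exp (- c) * diag_seminorm nabs e a w"
proof (rule antisym)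
  show "diag_seminorm nabs e (\<lambda>j. a j + ereal c) w \<le> exp (- c) * diag_seminorm nabs e a w"
    using le_diag_seminorm[of nabs e w _ a]
    by (auto simp: diag_seminorm_le_iff expneg_shift[OF assms] mult.left_commute)
  obtain j where "diag_seminorm nabs e a w = nabs (coord e w j) * expneg (a j)"
    by (rule diag_seminorm_attained)
  then show "exp (- c) * diag_seminorm nabs e a w \<le> diag_seminorm nabs e (\<lambda>j. a j + ereal c) w"
    using le_diag_seminorm[of nabs e w j "\<lambda>j. a j + ereal c"]
    by (simp add: expneg_shift[OF assms] mult.left_commute)
qed

context nonarch
begin

lemma seminorm_0:
  assumes "seminorm nabs s"
  shows "s 0 = 0"
proof -
  have "s (0 *s 0) = nabs 0 * s 0"
    using assms unfolding seminorm_def by blast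
  then show ?thesis
    by simp
qed

lemma seminorm_sum_le:
  assumes "seminorm nabs s" "0 \<le> c" "\<And>i. i \<in> A \<Longrightarrow> s (g i) \<le> c"
  shows "s (sum g A) \<le> c"
  using assms(3)
proof (induction A rule: infinite_finite_induct)
  case (insert x F)
  have "s (g x + sum g F) \<le> max (s (g x)) (s (sum g F))"
    using assms(1) unfolding seminorm_def by blast
  then show ?case
    using insert by force
qed (use assms(2) seminorm_0[OF assms(1)] in auto)

lemma diag_seminorm_nonneg: "0 \<le> diag_seminorm nabs e a w"
  by (metis diag_seminorm_attained expneg_nonneg mult_nonneg_nonneg nabs_nonneg)

lemma seminorm_diag_seminorm:
  assumes "is_basis e"
  shows "seminorm nabs (diag_seminorm nabs e a)"
  unfolding seminorm_def
proof (intro conjI allI)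
  show "0 \<le> diag_seminorm nabs e a w" for w
    by (rule diag_seminorm_nonneg)
  show "diag_seminorm nabs e a (c *s w) = nabs c * diag_seminorm nabs e a w" for c w
  proof (rule antisym)
    show "diag_seminorm nabs e a (c *s w) \<le> nabs c * diag_seminorm nabs e a w"
      by (auto simp: diag_seminorm_le_iff coord_scale[OF assms] nabs_mult mult.assoc
          intro!: mult_left_mono le_diag_seminorm nabs_nonneg)
    obtain j where "diag_seminorm nabs e a w = nabs (coord e w j) * expneg (a j)"
      by (rule diag_seminorm_attained)
    then show "nabs c * diag_seminorm nabs e a w \<le> diag_seminorm nabs e a (c *s w)"
      using le_diag_seminorm[of nabs e "c *s w" j a]
      by (simp add: coord_scale[OF assms] nabs_mult mult.assoc)
  qed
  show "diag_seminorm nabs e a (w + w') \<le> max (diag_seminorm nabs e a w) (diag_seminorm nabs e a w')"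
    for w w'
    unfolding diag_seminorm_le_iff
  proof
    fix j
    have "nabs (coord e (w + w') j) * expneg (a j)
        \<le> max (nabs (coord e w j)) (nabs (coord e w' j)) * expneg (a j)"
      by (simp add: coord_add[OF assms] mult_right_mono nabs_add_le)
    also have "\<dots> = max (nabs (coord e w j) * expneg (a j)) (nabs (coord e w' j) * expneg (a j))"
      by (simp add: max_mult_distrib_right)
    also have "\<dots> \<le> max (diag_seminorm nabs e a w) (diag_seminorm nabs e a w')"
      by (intro max.mono le_diag_seminorm)
    finally show "nabs (coord e (w + w') j) * expneg (a j)
        \<le> max (diag_seminorm nabs e a w) (diag_seminorm nabs e a w')" .
  qed
qed

lemma diag_seminorm_basis:
  assumes "is_basis e"
  shows "diag_seminorm nabs e a (e j) = expneg (a j)"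
proof (rule antisym)
  show "diag_seminorm nabs e a (e j) \<le> expneg (a j)"
    by (simp add: diag_seminorm_le_iff coord_basis[OF assms])
  show "expneg (a j) \<le> diag_seminorm nabs e a (e j)"
    using le_diag_seminorm[of nabs e "e j" j a] by (simp add: coord_basis[OF assms])
qed

text \<open>
  By the ultrametric inequality for the expansion in the basis, a diagonal seminorm is the largest one
  with prescribed bounds on the basis. This makes diagonal seminorms for different bases comparable.
\<close>

lemma seminorm_le_diag_seminorm:
  assumes "is_basis e" "seminorm nabs s" "\<And>j. s (e j) \<le> expneg (a j)"
  shows "s w \<le> diag_seminorm nabs e a w"
proof -
  have "s (\<Sum>j\<in>UNIV. coord e w j *s e j) \<le> diag_seminorm nabs e a w"
  proof (intro seminorm_sum_le[OF assms(2)] diag_seminorm_nonneg)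
    fix j
    have "s (coord e w j *s e j) = nabs (coord e w j) * s (e j)"
      using assms(2) by (simp add: seminorm_def)
    also have "\<dots> \<le> nabs (coord e w j) * expneg (a j)"
      by (intro mult_left_mono assms nabs_nonneg)
    also have "\<dots> \<le> diag_seminorm nabs e a w"
      by (rule le_diag_seminorm)
    finally show "s (coord e w j *s e j) \<le> diag_seminorm nabs e a w" .
  qed
  then show ?thesis
    by (simp add: sum_coord[OF assms(1)])
qed

lemma diag_seminorm_eq_0_iff:
  assumes "is_basis e" "\<And>j. a j \<noteq> \<infinity>"
  shows "diag_seminorm nabs e a w = 0 \<longleftrightarrow> w = 0"
proof
  assume *: "diag_seminorm nabs e a w = 0"
  show "w = 0"
  proof (rule ccontr)
    assume "w \<noteq> 0"
    then obtain j where "coord e w j \<noteq> 0"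
      using exists_coord_nonzero assms(1) by blast
    then have "0 < nabs (coord e w j) * expneg (a j)"
      using assms(2) by (simp add: less_le nabs_nonneg)
    then show False
      using le_diag_seminorm[of nabs e w j a] * by simp
  qed
qed (use seminorm_0[OF seminorm_diag_seminorm[OF assms(1)]] in simp)

lemma diag_seminorm_in_nontrivial:
  assumes "is_basis e" "a \<in> trop_cone"
  shows "diag_seminorm nabs e a \<in> nontrivial_seminorms nabs"
proof -
  obtain j where "a j \<noteq> \<infinity>"
    using assms(2) by (auto simp: trop_cone_def)
  then have "diag_seminorm nabs e a (e j) \<noteq> 0"
    by (simp add: diag_seminorm_basis[OF assms(1)])
  then show ?thesis
    using seminorm_diag_seminorm[OF assms(1)] by (auto simp: nontrivial_seminorms_def)
qed

end

lemma continuous_on_Max_range: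
  fixes g :: "'i::finite \<Rightarrow> 'a::topological_space \<Rightarrow> real"
  assumes "\<And>i. continuous_on S (g i)"
  shows "continuous_on S (\<lambda>x. Max (range (\<lambda>i. g i x)))"
proof -
  have "continuous_on S (\<lambda>x. Max ((\<lambda>i. g i x) ` I))" if "finite I" "I \<noteq> {}" for I
    using that
  proof (induction I rule: finite_ne_induct)
    case (insert i I)
    have "(\<lambda>x. Max ((\<lambda>i. g i x) ` insert i I)) = (\<lambda>x. max (g i x) (Max ((\<lambda>i. g i x) ` I)))"
      using insert by auto
    then show ?case
      using insert assms by (auto intro: continuous_on_max)
  qed (use assms in auto)
  then show ?thesis
    by simp
qed

lemma continuous_on_diag_seminorm:
  assumes "\<And>j. continuous_on S (\<lambda>x. expneg (a x j))"
  shows "continuous_on S (\<lambda>x. diag_seminorm nabs e (a x) w)"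
  unfolding diag_seminorm_def by (intro continuous_on_Max_range continuous_intros assms)

lemma continuous_on_expneg_coordinate: "continuous_on trop_cone (\<lambda>u. expneg (u i))"
  by (rule continuous_on_compose2[OF continuous_on_expneg])
    (auto intro: continuous_on_subset[OF continuous_on_product_coordinates] simp: trop_cone_def)

section \<open>Substituting linear forms into polynomials\<close>

lemma const_mpol_0 [simp]: "const_mpol 0 = 0"
  and const_mpol_1 [simp]: "const_mpol 1 = 1"
  and const_mpol_add: "const_mpol (c + d) = const_mpol c + const_mpol d"
  and const_mpol_mult: "const_mpol (c * d) = const_mpol c * const_mpol d"
  by (simp_all add: const_mpol_def single_add mult_single)

lemma const_mpol_sum: "const_mpol (sum g A) = (\<Sum>i\<in>A. const_mpol (g i))"
  by (induction A rule: infinite_finite_induct) (auto simp: const_mpol_add)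

lemma sum_single_lookup:
  "(\<Sum>m\<in>Poly_Mapping.keys p. Poly_Mapping.single m (Poly_Mapping.lookup p m)) = p"
proof (rule poly_mapping_eqI)
  fix k
  have "Poly_Mapping.lookup (\<Sum>m\<in>Poly_Mapping.keys p. Poly_Mapping.single m (Poly_Mapping.lookup p m)) k
      = (\<Sum>m\<in>Poly_Mapping.keys p. if m = k then Poly_Mapping.lookup p m else 0)"
    by (auto simp: lookup_sum lookup_single when_def intro!: sum.cong)
  also have "\<dots> = Poly_Mapping.lookup p k"
    by (auto simp: in_keys_iff)
  finally show "Poly_Mapping.lookup (\<Sum>m\<in>Poly_Mapping.keys p.
      Poly_Mapping.single m (Poly_Mapping.lookup p m)) k = Poly_Mapping.lookup p k" .
qed

lemma mult_eq_sum_single: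
  fixes p q :: "('a::monoid_add) \<Rightarrow>\<^sub>0 ('b::semiring_0)"
  shows "p * q = (\<Sum>m\<in>Poly_Mapping.keys p. \<Sum>m'\<in>Poly_Mapping.keys q.
    Poly_Mapping.single (m + m') (Poly_Mapping.lookup p m * Poly_Mapping.lookup q m'))"
proof -
  have "p * q = (\<Sum>m\<in>Poly_Mapping.keys p. Poly_Mapping.single m (Poly_Mapping.lookup p m))
      * (\<Sum>m\<in>Poly_Mapping.keys q. Poly_Mapping.single m (Poly_Mapping.lookup q m))"
    by (simp only: sum_single_lookup)
  then show ?thesis
    by (simp add: sum_product mult_single)
qed

definition monomial_image ::
  "('n::finite \<Rightarrow> 'k::field^'r::finite) \<Rightarrow> ('n \<Rightarrow>\<^sub>0 nat) \<Rightarrow> ('r, 'k) mpol" where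
  "monomial_image f m = (\<Prod>i\<in>UNIV. form_mpol (f i) ^ Poly_Mapping.lookup m i)"

lemma monomial_image_add: "monomial_image f (m + m') = monomial_image f m * monomial_image f m'"
  by (simp add: monomial_image_def lookup_add power_add prod.distrib)

text \<open>
  Sums over a common superset of the supports make the additivity of the substitution visible term by
  term.
\<close>

lemma imm_comorphism_superset:
  assumes "finite S" "Poly_Mapping.keys p \<subseteq> S"
  shows "imm_comorphism f p = (\<Sum>m\<in>S. const_mpol (Poly_Mapping.lookup p m) * monomial_image f m)"
  unfolding imm_comorphism_def monomial_image_def
  using assms by (intro sum.mono_neutral_left) (auto simp: in_keys_iff)

lemma imm_comorphism_single:
  "imm_comorphism f (Poly_Mapping.single m c) = const_mpol c * monomial_image f m"
  by (subst imm_comorphism_superset[of "{m}"]) auto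

lemma imm_comorphism_0 [simp]: "imm_comorphism f 0 = 0"
  by (simp add: imm_comorphism_def)

lemma imm_comorphism_add: "imm_comorphism f (p + q) = imm_comorphism f p + imm_comorphism f q"
proof -
  let ?S = "Poly_Mapping.keys p \<union> Poly_Mapping.keys q"
  show ?thesis
    using keys_add[of p q]
    by (simp add: imm_comorphism_superset[of ?S] lookup_add const_mpol_add distrib_right sum.distrib)
qed

lemma imm_comorphism_sum: "imm_comorphism f (sum g A) = (\<Sum>a\<in>A. imm_comorphism f (g a))"
  by (induction A rule: infinite_finite_induct) (auto simp: imm_comorphism_add)

lemma imm_comorphism_mult: "imm_comorphism f (p * q) = imm_comorphism f p * imm_comorphism f q"
proof -
  have "imm_comorphism f (p * q) = (\<Sum>m\<in>Poly_Mapping.keys p. \<Sum>m'\<in>Poly_Mapping.keys q.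
      (const_mpol (Poly_Mapping.lookup p m) * monomial_image f m)
      * (const_mpol (Poly_Mapping.lookup q m') * monomial_image f m'))"
    by (subst mult_eq_sum_single)
      (simp add: imm_comorphism_sum imm_comorphism_single const_mpol_mult monomial_image_add ac_simps)
  also have "\<dots> = imm_comorphism f p * imm_comorphism f q"
    by (simp add: imm_comorphism_def monomial_image_def sum_product)
  finally show ?thesis .
qed

lemma imm_comorphism_const [simp]: "imm_comorphism f (const_mpol c) = const_mpol c"
  by (subst const_mpol_def) (simp add: imm_comorphism_single monomial_image_def)

lemma imm_comorphism_var [simp]: "imm_comorphism f (var_mpol i) = form_mpol (f i)"
proof -
  have "monomial_image f (Poly_Mapping.single i 1)
      = (\<Prod>j\<in>UNIV. if j = i then form_mpol (f j) else 1)"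
    unfolding monomial_image_def by (intro prod.cong) (auto simp: lookup_single when_def)
  then show ?thesis
    by (simp add: var_mpol_def imm_comorphism_single)
qed

lemma imm_comorphism_power: "imm_comorphism f (p ^ k) = imm_comorphism f p ^ k"
proof (induction k)
  case 0
  then show ?case
    using imm_comorphism_const[of f 1] by simp
qed (simp add: imm_comorphism_mult)

lemma imm_comorphism_prod: "imm_comorphism f (prod g A) = (\<Prod>a\<in>A. imm_comorphism f (g a))"
  using imm_comorphism_const[of f 1]
  by (induction A rule: infinite_finite_induct) (auto simp: imm_comorphism_mult)

lemma pull_form_nth: "pull_form f g $ j = (\<Sum>i\<in>UNIV. g $ i * f i $ j)"
  by (simp add: pull_form_def)

lemma pull_form_add: "pull_form f (g + h) = pull_form f g + pull_form f h"
  by (simp add: vec_eq_iff pull_form_nth distrib_right sum.distrib)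

lemma pull_form_scale: "pull_form f (c *s g) = c *s pull_form f g"
  by (simp add: vec_eq_iff pull_form_nth sum_distrib_left mult.assoc)

lemma pull_form_axis [simp]: "pull_form f (axis i 1) = f i"
  by (simp add: vec_eq_iff pull_form_nth axis_def if_distrib[of "\<lambda>x. x * _"] cong: if_cong)

lemma imm_comorphism_form: "imm_comorphism f (form_mpol g) = form_mpol (pull_form f g)"
proof -
  have "imm_comorphism f (form_mpol g) = (\<Sum>i\<in>UNIV. const_mpol (g $ i) * form_mpol (f i))"
    by (simp add: form_mpol_def[of g] imm_comorphism_sum imm_comorphism_mult)
  also have "\<dots> = (\<Sum>i\<in>UNIV. \<Sum>j\<in>UNIV. const_mpol (g $ i * f i $ j) * var_mpol j)"
    by (simp add: form_mpol_def const_mpol_mult sum_distrib_left mult.assoc)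
  also have "\<dots> = form_mpol (pull_form f g)"
    by (subst sum.swap) (simp add: form_mpol_def pull_form_nth const_mpol_sum sum_distrib_right)
  finally show ?thesis .
qed

lemma imm_comorphism_comp:
  "imm_comorphism g (imm_comorphism f p) = imm_comorphism (\<lambda>i. pull_form g (f i)) p"
  by (simp add: imm_comorphism_def[of f] imm_comorphism_def[of "\<lambda>i. pull_form g (f i)"]
      imm_comorphism_sum imm_comorphism_mult imm_comorphism_prod imm_comorphism_power imm_comorphism_form)

lemma form_mpol_add: "form_mpol (g + h) = form_mpol g + form_mpol h"
  by (simp add: form_mpol_def const_mpol_add distrib_right sum.distrib)

lemma form_mpol_scale: "form_mpol (c *s g) = const_mpol c * form_mpol g"
  by (simp add: form_mpol_def const_mpol_mult sum_distrib_left mult.assoc)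

lemma form_mpol_0 [simp]: "form_mpol 0 = 0"
  by (simp add: form_mpol_def)

lemma form_mpol_axis [simp]: "form_mpol (axis i 1) = var_mpol i"
  by (simp add: form_mpol_def axis_def if_distrib[of const_mpol] if_distrib[of "\<lambda>x. x * _"] cong: if_cong)


section \<open>Homogeneous components\<close>

lemma homogeneous_0 [simp]: "homogeneous d 0"
  by (simp add: homogeneous_def)

lemma homogeneous_add: "homogeneous d p \<Longrightarrow> homogeneous d q \<Longrightarrow> homogeneous d (p + q)"
  using keys_add[of p q] by (auto simp: homogeneous_def)

lemma homogeneous_sum: "(\<And>a. a \<in> A \<Longrightarrow> homogeneous d (g a)) \<Longrightarrow> homogeneous d (sum g A)"
  by (induction A rule: infinite_finite_induct) (auto intro: homogeneous_add)

lemma homogeneous_mult: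
  assumes "homogeneous d p" "homogeneous d' q"
  shows "homogeneous (d + d') (p * q)"
  unfolding homogeneous_def
proof
  fix m assume "m \<in> Poly_Mapping.keys (p * q)"
  then obtain a b where "m = a + b" "a \<in> Poly_Mapping.keys p" "b \<in> Poly_Mapping.keys q"
    using keys_mult[of p q] by auto
  then show "(\<Sum>i\<in>UNIV. Poly_Mapping.lookup m i) = d + d'"
    using assms by (auto simp: homogeneous_def lookup_add sum.distrib)
qed

lemma homogeneous_const: "homogeneous 0 (const_mpol c)"
  by (auto simp: homogeneous_def const_mpol_def)

lemma homogeneous_var: "homogeneous 1 (var_mpol i)"
  by (auto simp: homogeneous_def var_mpol_def lookup_single when_def)

lemma homogeneous_form: "homogeneous 1 (form_mpol g)"
  unfolding form_mpol_def
  using homogeneous_mult[OF homogeneous_const homogeneous_var] by (intro homogeneous_sum) simp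

lemma homogeneous_power: "homogeneous d p \<Longrightarrow> homogeneous (k * d) (p ^ k)"
  using homogeneous_const[of 1] by (induction k) (auto intro: homogeneous_mult)

lemma homogeneous_prod:
  "(\<And>a. a \<in> A \<Longrightarrow> homogeneous (d a) (g a)) \<Longrightarrow> finite A \<Longrightarrow> homogeneous (sum d A) (prod g A)"
  using homogeneous_const[of 1]
  by (induction A rule: infinite_finite_induct) (auto intro: homogeneous_mult)

lemma homogeneous_imm_comorphism:
  assumes "homogeneous d p"
  shows "homogeneous d (imm_comorphism f p)"
  unfolding imm_comorphism_def
proof (rule homogeneous_sum)
  fix m assume m: "m \<in> Poly_Mapping.keys p"
  have "homogeneous (\<Sum>i\<in>UNIV. Poly_Mapping.lookup m i * 1)
      (\<Prod>i\<in>UNIV. form_mpol (f i) ^ Poly_Mapping.lookup m i)"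
    by (intro homogeneous_prod homogeneous_power homogeneous_form) auto
  then have "homogeneous d (\<Prod>i\<in>UNIV. form_mpol (f i) ^ Poly_Mapping.lookup m i)"
    using assms m by (simp add: homogeneous_def)
  then show "homogeneous d (const_mpol (Poly_Mapping.lookup p m) *
      (\<Prod>i\<in>UNIV. form_mpol (f i) ^ Poly_Mapping.lookup m i))"
    using homogeneous_mult[OF homogeneous_const] by force
qed

text \<open>
  Substituting linear forms preserves the degree, so the components of different degrees cannot
  cancel each other: the kernel is a homogeneous ideal.
\<close>

lemma kernel_homogeneous_decomposition:
  fixes f :: "'n::finite \<Rightarrow> 'k::field^'r::finite"
  assumes "imm_comorphism f p = 0"
  obtains D g where "finite D" "p = sum g D" "\<And>d. d \<in> D \<Longrightarrow> homogeneous d (g d)"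
    "\<And>d. d \<in> D \<Longrightarrow> imm_comorphism f (g d) = 0"
proof
  let ?deg = "\<lambda>m :: 'n \<Rightarrow>\<^sub>0 nat. \<Sum>i\<in>UNIV. Poly_Mapping.lookup m i"
  let ?D = "?deg ` Poly_Mapping.keys p"
  let ?g = "\<lambda>d. \<Sum>m | m \<in> Poly_Mapping.keys p \<and> ?deg m = d.
    Poly_Mapping.single m (Poly_Mapping.lookup p m)"
  show "finite ?D"
    by simp
  have "sum ?g ?D = (\<Sum>m\<in>Poly_Mapping.keys p. Poly_Mapping.single m (Poly_Mapping.lookup p m))"
    by (rule sum.group) auto
  then show p: "p = sum ?g ?D"
    by (simp add: sum_single_lookup)
  show hom: "homogeneous d (?g d)" for d
    by (rule homogeneous_sum) (auto simp: homogeneous_def)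
  show "imm_comorphism f (?g d) = 0" if d: "d \<in> ?D" for d
  proof (rule poly_mapping_eqI)
    fix m
    have deg: "Poly_Mapping.lookup (imm_comorphism f (?g d')) m = 0"
      if "(\<Sum>i\<in>UNIV. Poly_Mapping.lookup m i) \<noteq> d'" for d'
      using homogeneous_imm_comorphism[OF hom[of d'], of f] that
      by (auto simp: homogeneous_def in_keys_iff)
    show "Poly_Mapping.lookup (imm_comorphism f (?g d)) m = Poly_Mapping.lookup 0 m"
    proof (cases "(\<Sum>i\<in>UNIV. Poly_Mapping.lookup m i) = d")
      case True
      have "0 = Poly_Mapping.lookup (imm_comorphism f (sum ?g ?D)) m"
        using p assms by simp
      also have "\<dots> = (\<Sum>d'\<in>?D. Poly_Mapping.lookup (imm_comorphism f (?g d')) m)"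
        by (simp add: imm_comorphism_sum lookup_sum)
      also have "\<dots> = (\<Sum>d'\<in>{d}. Poly_Mapping.lookup (imm_comorphism f (?g d')) m)"
        using True d by (intro sum.mono_neutral_right) (auto intro: deg)
      finally show ?thesis
        by simp
    qed (use deg in auto)
  qed
qed


section \<open>Gauss norms\<close>

definition monomial_weight :: "('r::finite \<Rightarrow> real) \<Rightarrow> ('r \<Rightarrow>\<^sub>0 nat) \<Rightarrow> real" where
  "monomial_weight \<rho> m = (\<Prod>j\<in>UNIV. \<rho> j ^ Poly_Mapping.lookup m j)"

text \<open>
  The element \<open>0\<close> accounts for the zero polynomial, whose set of monomials is empty.
\<close>

definition gauss_norm ::
  "('k::field \<Rightarrow> real) \<Rightarrow> ('r::finite \<Rightarrow> real) \<Rightarrow> ('r, 'k) mpol \<Rightarrow> real" where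
  "gauss_norm nabs \<rho> p =
     Max (insert 0 ((\<lambda>m. nabs (Poly_Mapping.lookup p m) * monomial_weight \<rho> m) ` Poly_Mapping.keys p))"

lemma monomial_weight_add: "monomial_weight \<rho> (m + m') = monomial_weight \<rho> m * monomial_weight \<rho> m'"
  by (simp add: monomial_weight_def lookup_add power_add prod.distrib)

lemma monomial_weight_nonneg: "(\<And>j. 0 \<le> \<rho> j) \<Longrightarrow> 0 \<le> monomial_weight \<rho> m"
  by (simp add: monomial_weight_def prod_nonneg)

lemma monomial_weight_0 [simp]: "monomial_weight \<rho> 0 = 1"
  by (simp add: monomial_weight_def)

lemma monomial_weight_single [simp]: "monomial_weight \<rho> (Poly_Mapping.single j 1) = \<rho> j"
proof -
  have "monomial_weight \<rho> (Poly_Mapping.single j 1) = (\<Prod>i\<in>UNIV. if i = j then \<rho> i else 1)"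
    unfolding monomial_weight_def by (intro prod.cong) (auto simp: lookup_single when_def)
  then show ?thesis
    by simp
qed

text \<open>
  Of all pairs in \<open>A \<times> A'\<close>, one whose sum has maximal Euclidean length is the only pair with that
  sum: if \<open>a + b = x + y\<close> then this sum is the midpoint of \<open>a + y\<close> and \<open>x + b\<close>, so by strict
  convexity one of these is longer unless \<open>y = b\<close>. Such a pair plays the role of a pair of leading
  monomials in the proof that Gauss norms are multiplicative.
\<close>

lemma exists_uniquely_decomposed_sum:
  fixes A A' :: "('r::finite \<Rightarrow>\<^sub>0 nat) set"
  assumes "finite A" "finite A'" "A \<noteq> {}" "A' \<noteq> {}"
  obtains a b where "a \<in> A" "b \<in> A'"
    "\<And>x y. x \<in> A \<Longrightarrow> y \<in> A' \<Longrightarrow> x + y = a + b \<Longrightarrow> x = a \<and> y = b"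
proof -
  define N where "N = (\<lambda>m :: 'r \<Rightarrow>\<^sub>0 nat. \<Sum>i\<in>UNIV. (int (Poly_Mapping.lookup m i))\<^sup>2)"
  let ?S = "(\<lambda>(a, b). N (a + b)) ` (A \<times> A')"
  have "Max ?S \<in> ?S"
    using assms by (intro Max_in) auto
  then obtain a b where ab: "a \<in> A" "b \<in> A'" "N (a + b) = Max ?S"
    by auto
  have max: "N (x + y) \<le> N (a + b)" if "x \<in> A" "y \<in> A'" for x y
    unfolding ab using that assms by (intro Max_ge) auto
  have "x = a \<and> y = b" if xy: "x \<in> A" "y \<in> A'" "x + y = a + b" for x y
  proof -
    let ?l = "\<lambda>m i. int (Poly_Mapping.lookup m i)"
    have eq: "?l x i + ?l y i = ?l a i + ?l b i" for i
      using arg_cong[OF xy(3), of "\<lambda>m. int (Poly_Mapping.lookup m i)"] by (simp add: lookup_add)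
    have "N (a + y) + N (x + b) = (\<Sum>i\<in>UNIV. (?l a i + ?l y i)\<^sup>2 + (?l x i + ?l b i)\<^sup>2)"
      by (simp add: N_def lookup_add sum.distrib)
    also have "\<dots> = (\<Sum>i\<in>UNIV. 2 * (?l a i + ?l b i)\<^sup>2 + 2 * (?l y i - ?l b i)\<^sup>2)"
    proof (rule sum.cong)
      fix i
      have x: "?l x i = ?l a i + ?l b i - ?l y i"
        using eq[of i] by simp
      show "(?l a i + ?l y i)\<^sup>2 + (?l x i + ?l b i)\<^sup>2
          = 2 * (?l a i + ?l b i)\<^sup>2 + 2 * (?l y i - ?l b i)\<^sup>2"
        unfolding x by (simp add: power2_eq_square algebra_simps)
    qed simp
    also have "\<dots> = 2 * N (a + b) + 2 * (\<Sum>i\<in>UNIV. (?l y i - ?l b i)\<^sup>2)"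
      by (simp add: N_def lookup_add sum.distrib sum_distrib_left)
    finally have "(\<Sum>i\<in>UNIV. (?l y i - ?l b i)\<^sup>2) \<le> 0"
      using max[of a y] max[of x b] xy ab by simp
    then have "(\<Sum>i\<in>UNIV. (?l y i - ?l b i)\<^sup>2) = 0"
      by (intro antisym sum_nonneg) auto
    then have "?l y i = ?l b i" for i
      by (simp add: sum_nonneg_eq_0_iff)
    then have "y = b"
      by (intro poly_mapping_eqI) simp
    then show ?thesis
      using xy(3) by simp
  qed
  then show ?thesis
    using that ab by blast
qed

context nonarch
begin

lemma nabs_sum_less:
  assumes "0 < c" "\<And>i. i \<in> A \<Longrightarrow> nabs (g i) < c"
  shows "nabs (sum g A) < c"
  using assms(2)
proof (induction A rule: infinite_finite_induct)
  case (insert x F)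
  then show ?case
    using nabs_add_le[of "g x" "sum g F"] by force
qed (use assms in auto)

context
  fixes \<rho> :: "'r::finite \<Rightarrow> real"
  assumes nonneg: "\<And>j. 0 \<le> \<rho> j"
begin

lemma term_le_gauss_norm:
  "nabs (Poly_Mapping.lookup p m) * monomial_weight \<rho> m \<le> gauss_norm nabs \<rho> p"
proof (cases "m \<in> Poly_Mapping.keys p")
  case False
  then show ?thesis
    by (simp add: gauss_norm_def in_keys_iff)
qed (simp add: gauss_norm_def)

lemma gauss_norm_nonneg: "0 \<le> gauss_norm nabs \<rho> p"
  by (simp add: gauss_norm_def)

lemma gauss_norm_le:
  assumes "0 \<le> c" "\<And>m. nabs (Poly_Mapping.lookup p m) * monomial_weight \<rho> m \<le> c"
  shows "gauss_norm nabs \<rho> p \<le> c"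
  using assms by (simp add: gauss_norm_def)

lemma gauss_norm_const: "gauss_norm nabs \<rho> (const_mpol c) = nabs c"
proof (rule antisym)
  show "gauss_norm nabs \<rho> (const_mpol c) \<le> nabs c"
    by (rule gauss_norm_le) (auto simp: const_mpol_def lookup_single when_def nabs_nonneg)
  show "nabs c \<le> gauss_norm nabs \<rho> (const_mpol c)"
    using term_le_gauss_norm[of "const_mpol c" 0] by (simp add: const_mpol_def)
qed

lemma gauss_norm_add_le:
  "gauss_norm nabs \<rho> (p + q) \<le> max (gauss_norm nabs \<rho> p) (gauss_norm nabs \<rho> q)"
proof (rule gauss_norm_le)
  fix m
  have "nabs (Poly_Mapping.lookup (p + q) m) * monomial_weight \<rho> m
      \<le> max (nabs (Poly_Mapping.lookup p m)) (nabs (Poly_Mapping.lookup q m)) * monomial_weight \<rho> m"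
    by (simp add: lookup_add mult_right_mono nabs_add_le monomial_weight_nonneg nonneg)
  also have "\<dots> = max (nabs (Poly_Mapping.lookup p m) * monomial_weight \<rho> m)
      (nabs (Poly_Mapping.lookup q m) * monomial_weight \<rho> m)"
    by (simp add: max_mult_distrib_right monomial_weight_nonneg nonneg)
  also have "\<dots> \<le> max (gauss_norm nabs \<rho> p) (gauss_norm nabs \<rho> q)"
    by (intro max.mono term_le_gauss_norm)
  finally show "nabs (Poly_Mapping.lookup (p + q) m) * monomial_weight \<rho> m
      \<le> max (gauss_norm nabs \<rho> p) (gauss_norm nabs \<rho> q)" .
qed (simp add: gauss_norm_nonneg le_max_iff_disj)

lemma lookup_mult_eq_sum:
  "Poly_Mapping.lookup (p * q) c = (\<Sum>(m, m')\<in>Poly_Mapping.keys p \<times> Poly_Mapping.keys q.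
     if m + m' = c then Poly_Mapping.lookup p m * Poly_Mapping.lookup q m' else 0)"
  by (subst mult_eq_sum_single)
    (simp add: lookup_sum lookup_single when_def sum.cartesian_product case_prod_unfold)

lemma nabs_product_term:
  "nabs (Poly_Mapping.lookup p m * Poly_Mapping.lookup q m') * monomial_weight \<rho> (m + m')
    = (nabs (Poly_Mapping.lookup p m) * monomial_weight \<rho> m)
    * (nabs (Poly_Mapping.lookup q m') * monomial_weight \<rho> m')"
  by (simp add: nabs_mult monomial_weight_add)

lemma gauss_norm_mult_le: "gauss_norm nabs \<rho> (p * q) \<le> gauss_norm nabs \<rho> p * gauss_norm nabs \<rho> q"
proof (rule gauss_norm_le)
  fix c
  let ?P = "gauss_norm nabs \<rho> p" and ?Q = "gauss_norm nabs \<rho> q"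
  show "0 \<le> ?P * ?Q"
    by (simp add: gauss_norm_nonneg)
  show "nabs (Poly_Mapping.lookup (p * q) c) * monomial_weight \<rho> c \<le> ?P * ?Q"
  \<comment> \<open>The numbers \<open>\<rho> j\<close> may vanish, and dividing by a vanishing weight would lose the bound.\<close>
  proof (cases "monomial_weight \<rho> c = 0")
    case True
    then show ?thesis
      by (simp add: gauss_norm_nonneg)
  next
    case False
    then have pos: "0 < monomial_weight \<rho> c"
      using monomial_weight_nonneg[of \<rho> c] nonneg by simp
    have "nabs (Poly_Mapping.lookup (p * q) c) \<le> ?P * ?Q / monomial_weight \<rho> c"
      unfolding lookup_mult_eq_sum
    proof (intro nabs_sum_le)
      show "0 \<le> ?P * ?Q / monomial_weight \<rho> c"
        using pos by (simp add: gauss_norm_nonneg)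
      fix mm assume "mm \<in> Poly_Mapping.keys p \<times> Poly_Mapping.keys q"
      obtain m m' where mm: "mm = (m, m')"
        by fastforce
      have "nabs (Poly_Mapping.lookup p m * Poly_Mapping.lookup q m') * monomial_weight \<rho> c \<le> ?P * ?Q"
        if "m + m' = c"
        unfolding that[symmetric] nabs_product_term
        by (intro mult_mono term_le_gauss_norm gauss_norm_nonneg)
          (simp add: nabs_nonneg monomial_weight_nonneg nonneg)
      then show "nabs (case mm of (m, m') \<Rightarrow> if m + m' = c
          then Poly_Mapping.lookup p m * Poly_Mapping.lookup q m' else 0) \<le> ?P * ?Q / monomial_weight \<rho> c"
        using pos by (simp add: mm pos_le_divide_eq gauss_norm_nonneg)
    qed
    then show ?thesis
      using pos by (simp add: pos_le_divide_eq)
  qed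
qed

lemma gauss_norm_attained:
  assumes "gauss_norm nabs \<rho> p \<noteq> 0"
  shows "\<exists>m\<in>Poly_Mapping.keys p.
    nabs (Poly_Mapping.lookup p m) * monomial_weight \<rho> m = gauss_norm nabs \<rho> p"
proof -
  have "gauss_norm nabs \<rho> p
      \<in> insert 0 ((\<lambda>m. nabs (Poly_Mapping.lookup p m) * monomial_weight \<rho> m) ` Poly_Mapping.keys p)"
    unfolding gauss_norm_def by (intro Max_in) auto
  then show ?thesis
    using assms by auto
qed

text \<open>
  Among the pairs of monomials that attain the two norms, one has a sum which no other such pair has.
  At this sum its contribution strictly dominates the coefficient of the product.
\<close>

lemma gauss_norm_mult: "gauss_norm nabs \<rho> (p * q) = gauss_norm nabs \<rho> p * gauss_norm nabs \<rho> q"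
proof (cases "gauss_norm nabs \<rho> p = 0 \<or> gauss_norm nabs \<rho> q = 0")
  case True
  then show ?thesis
    using gauss_norm_mult_le[of p q] gauss_norm_nonneg[of "p * q"] by auto
next
  case False
  let ?P = "gauss_norm nabs \<rho> p" and ?Q = "gauss_norm nabs \<rho> q"
  let ?t = "\<lambda>p m. nabs (Poly_Mapping.lookup p m) * monomial_weight \<rho> m"
  define A where "A = {m \<in> Poly_Mapping.keys p. ?t p m = ?P}"
  define A' where "A' = {m \<in> Poly_Mapping.keys q. ?t q m = ?Q}"
  have P: "0 < ?P" and Q: "0 < ?Q"
    using False gauss_norm_nonneg by (simp_all add: less_le)
  have "A \<noteq> {}" "A' \<noteq> {}"
    using gauss_norm_attained False by (auto simp: A_def A'_def)
  moreover have "finite A" "finite A'"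
    by (simp_all add: A_def A'_def)
  ultimately obtain a b where ab: "a \<in> A" "b \<in> A'"
    and uniq: "\<And>x y. x \<in> A \<Longrightarrow> y \<in> A' \<Longrightarrow> x + y = a + b \<Longrightarrow> x = a \<and> y = b"
    using exists_uniquely_decomposed_sum by metis
  let ?w = "monomial_weight \<rho> (a + b)"
  let ?h = "\<lambda>(m, m'). if m + m' = a + b then Poly_Mapping.lookup p m * Poly_Mapping.lookup q m' else 0"
  have top: "nabs (?h (a, b)) * ?w = ?P * ?Q"
    using ab by (simp add: nabs_product_term A_def A'_def)
  have "?w \<noteq> 0" and h_neq_0: "?h (a, b) \<noteq> 0"
    using top P Q by auto
  then have w: "0 < ?w"
    using monomial_weight_nonneg[of \<rho> "a + b"] nonneg by (simp add: less_le)
  have nn: "0 \<le> ?t r k" for r k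
    by (simp add: nabs_nonneg monomial_weight_nonneg nonneg)
  have less: "nabs (?h mm) < nabs (?h (a, b))"
    if mm: "mm \<in> Poly_Mapping.keys p \<times> Poly_Mapping.keys q - {(a, b)}" for mm
  proof -
    obtain m m' where [simp]: "mm = (m, m')"
      by fastforce
    show ?thesis
    proof (cases "m + m' = a + b")
      case True
      then have "m \<notin> A \<or> m' \<notin> A'"
        using uniq mm by auto
      then have "?t p m < ?P \<or> ?t q m' < ?Q"
        using mm term_le_gauss_norm[of p m] term_le_gauss_norm[of q m'] by (auto simp: A_def A'_def)
      then have "?t p m * ?t q m' < ?P * ?Q"
      proof
        assume "?t p m < ?P"
        then show ?thesis
          using Q mult_left_mono[OF term_le_gauss_norm[of q m'] nn[of p m]]
          by (meson le_less_trans mult_strict_right_mono)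
      next
        assume "?t q m' < ?Q"
        then show ?thesis
          using P mult_right_mono[OF term_le_gauss_norm[of p m] nn[of q m']]
          by (meson le_less_trans mult_strict_left_mono)
      qed
      then have "nabs (?h mm) * ?w < nabs (?h (a, b)) * ?w"
        unfolding top using True nabs_product_term[of p m q m'] by simp
      then show ?thesis
        using w by simp
    next
      case False
      then show ?thesis
        using h_neq_0 nabs_nonneg[of "?h (a, b)"] by (simp add: less_le)
    qed
  qed
  have "Poly_Mapping.lookup (p * q) (a + b) = ?h (a, b)
      + sum ?h (Poly_Mapping.keys p \<times> Poly_Mapping.keys q - {(a, b)})"
    unfolding lookup_mult_eq_sum using ab by (subst sum.remove[of _ "(a, b)"]) (auto simp: A_def A'_def)
  moreover have "0 < nabs (?h (a, b))"
    using h_neq_0 nabs_nonneg[of "?h (a, b)"] by (simp add: less_le)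
  ultimately have "nabs (Poly_Mapping.lookup (p * q) (a + b)) = nabs (?h (a, b))"
    using less by (simp only:) (intro nabs_add_dominant nabs_sum_less)
  then have "?P * ?Q \<le> gauss_norm nabs \<rho> (p * q)"
    using term_le_gauss_norm[of "p * q" "a + b"] top by simp
  then show ?thesis
    using gauss_norm_mult_le[of p q] by simp
qed

lemma single_one_eq_iff: "Poly_Mapping.single i (1::nat) = Poly_Mapping.single j 1 \<longleftrightarrow> i = j"
  by (metis lookup_single_eq lookup_single_not_eq zero_neq_one)

lemma lookup_form_mpol: "Poly_Mapping.lookup (form_mpol g) m
    = (\<Sum>j\<in>UNIV. if m = Poly_Mapping.single j 1 then g $ j else 0)"
  by (auto simp: form_mpol_def const_mpol_def var_mpol_def mult_single lookup_sum lookup_single when_def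
      intro!: sum.cong)

lemma gauss_norm_form: "gauss_norm nabs \<rho> (form_mpol g) = Max (range (\<lambda>j. nabs (g $ j) * \<rho> j))"
proof (rule antisym)
  have at_single: "Poly_Mapping.lookup (form_mpol g) (Poly_Mapping.single j 1) = g $ j" for j
    by (simp only: lookup_form_mpol single_one_eq_iff) simp
  show "gauss_norm nabs \<rho> (form_mpol g) \<le> Max (range (\<lambda>j. nabs (g $ j) * \<rho> j))"
  proof (rule gauss_norm_le)
    fix j :: 'r
    have "0 \<le> nabs (g $ j) * \<rho> j"
      by (simp add: nabs_nonneg nonneg)
    also have "\<dots> \<le> Max (range (\<lambda>j. nabs (g $ j) * \<rho> j))"
      by (intro Max_ge) auto
    finally show nn: "0 \<le> Max (range (\<lambda>j. nabs (g $ j) * \<rho> j))" .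
    fix m
    show "nabs (Poly_Mapping.lookup (form_mpol g) m) * monomial_weight \<rho> m
        \<le> Max (range (\<lambda>j. nabs (g $ j) * \<rho> j))"
    proof (cases "\<exists>j. m = Poly_Mapping.single j 1")
      case True
      then obtain j where "m = Poly_Mapping.single j 1"
        by blast
      then have "nabs (Poly_Mapping.lookup (form_mpol g) m) * monomial_weight \<rho> m = nabs (g $ j) * \<rho> j"
        by (simp only: at_single monomial_weight_single)
      then show ?thesis
        by simp
    qed (use nn in \<open>simp add: lookup_form_mpol\<close>)
  qed
  show "Max (range (\<lambda>j. nabs (g $ j) * \<rho> j)) \<le> gauss_norm nabs \<rho> (form_mpol g)"
    proof (rule Max.boundedI)
    fix x assume "x \<in> range (\<lambda>j. nabs (g $ j) * \<rho> j)"
    then obtain j where "x = nabs (g $ j) * \<rho> j"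
      by blast
    then show "x \<le> gauss_norm nabs \<rho> (form_mpol g)"
      using term_le_gauss_norm[of "form_mpol g" "Poly_Mapping.single j 1"]
      by (simp only: at_single monomial_weight_single)
  qed auto
qed

end

end

section \<open>Tropicalization in terms of seminorms\<close>

lemma trop_cone_shift:
  assumes "u \<in> trop_cone"
  shows "(\<lambda>i. u i + ereal c) \<in> trop_cone"
proof -
  have "u i + ereal c = \<infinity> \<longleftrightarrow> u i = \<infinity>" "u i + ereal c = -\<infinity> \<longleftrightarrow> u i = -\<infinity>" for i
    by (cases "u i"; simp)+
  then show ?thesis
    using assms by (simp add: trop_cone_def)
qed

lemma equiv_trop_rel: "equiv (trop_cone :: ('n::finite \<Rightarrow> ereal) set) trop_rel"
proof (rule equivI)
  show "(trop_rel :: (('n \<Rightarrow> ereal) \<times> _) set) \<subseteq> trop_cone \<times> trop_cone"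
    by (auto simp: trop_rel_def)
  show "refl_on (trop_cone :: ('n \<Rightarrow> ereal) set) trop_rel"
    by (auto simp: refl_on_def trop_rel_def zero_ereal_def[symmetric] intro!: exI[of _ 0])
  show "sym (trop_rel :: (('n \<Rightarrow> ereal) \<times> _) set)"
  proof (rule symI)
    fix u v :: "'n \<Rightarrow> ereal" assume "(u, v) \<in> trop_rel"
    then obtain c where *: "u \<in> trop_cone" "v \<in> trop_cone" "v i = u i + ereal c" for i
      by (auto simp: trop_rel_def)
    have "u i = v i + ereal (- c)" for i
      unfolding * by (cases "u i") auto
    with * show "(v, u) \<in> trop_rel"
      by (auto simp: trop_rel_def)
  qed
  show "trans (trop_rel :: (('n \<Rightarrow> ereal) \<times> _) set)"
  proof (rule transI)
    fix u v w :: "'n \<Rightarrow> ereal" assume uv: "(u, v) \<in> trop_rel" and vw: "(v, w) \<in> trop_rel"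
    from uv obtain c where *: "u \<in> trop_cone" "v \<in> trop_cone" "v i = u i + ereal c" for i
      by (auto simp: trop_rel_def)
    from vw obtain d where **: "w \<in> trop_cone" "w i = v i + ereal d" for i
      by (auto simp: trop_rel_def)
    have "w i = u i + ereal (c + d)" for i
      unfolding * ** by (cases "u i") auto
    with *(1) **(1) show "(u, w) \<in> trop_rel"
      unfolding trop_rel_def by blast
  qed
qed

lemma trop_class_shift:
  assumes "u \<in> trop_cone"
  shows "trop_rel `` {\<lambda>i. u i + ereal c} = trop_rel `` {u}"
  using assms trop_cone_shift[OF assms, of c]
  by (intro equiv_class_eq[OF equiv_trop_rel, symmetric]) (auto simp: trop_rel_def)

lemma pull_form_surj:
  assumes "linear_immersion f"
  obtains g where "pull_form f g = w"
proof -
  have "vec.span (range f) \<subseteq> range (pull_form f)"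
  proof (rule vec.span_minimal)
    show "range f \<subseteq> range (pull_form f)"
      by (metis image_subsetI pull_form_axis rangeI)
    have "0 = pull_form f 0"
      by (simp add: vec_eq_iff pull_form_nth)
    then show "vec.subspace (range (pull_form f))"
      unfolding vec.subspace_def
      by (auto simp: pull_form_add[symmetric] pull_form_scale[symmetric])
  qed
  then have "w \<in> range (pull_form f)"
    using assms by (auto simp: linear_immersion_def)
  then show ?thesis
    using that by blast
qed

context nonarch
begin

text \<open>
  Homogeneous coordinates for the image of the class of \<open>s\<close> under \<open>trop \<circ> B(\<iota>)\<close>; compare
  \<open>trop_building_map_class\<close>.
\<close>

definition trop_lift :: "('n::finite \<Rightarrow> 'k^'r::finite) \<Rightarrow> ('k^'r \<Rightarrow> real) \<Rightarrow> 'n \<Rightarrow> ereal" where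
  "trop_lift f s i = neglog (s (f i))"

lemma seminorm_vanishes_if_on_generators:
  assumes "linear_immersion f" "seminorm nabs s" "\<And>i. s (f i) = 0"
  shows "s w = 0"
proof -
  obtain g where g: "pull_form f g = w"
    using pull_form_surj[OF assms(1)] by blast
  have "s (pull_form f g) \<le> 0"
    unfolding pull_form_def
    using assms(2,3) by (intro seminorm_sum_le[OF assms(2)]) (auto simp: seminorm_def)
  then show ?thesis
    using g assms(2) by (metis antisym seminorm_def)
qed

lemma trop_lift_in_trop_cone:
  assumes "linear_immersion f" "s \<in> nontrivial_seminorms nabs"
  shows "trop_lift f s \<in> trop_cone"
  using assms seminorm_vanishes_if_on_generators[of f s]
  by (auto simp: trop_cone_def nontrivial_seminorms_def trop_lift_def)

lemma an_cone_0: "x \<in> an_cone nabs \<Longrightarrow> x 0 = 0"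
  using const_mpol_0 nabs_0 by (metis (mono_tags, lifting) an_cone_def mem_Collect_eq)

lemma an_cone_sum_zero:
  assumes "x \<in> an_cone nabs" "\<And>a. a \<in> A \<Longrightarrow> x (g a) = 0"
  shows "x (sum g A) = 0"
  using assms(2)
proof (induction A rule: infinite_finite_induct)
  case (insert a F)
  have "0 \<le> x (g a + sum g F)" "x (g a + sum g F) \<le> max (x (g a)) (x (sum g F))"
    using assms(1) by (auto simp: an_cone_def)
  then show ?case
    using insert by simp
qed (use an_cone_0[OF assms(1)] in auto)

lemma an_cone_add_vanishing:
  assumes "x \<in> an_cone nabs" "x q = 0"
  shows "x (p + q) = x p"
proof (rule antisym)
  have le: "x (a + b) \<le> max (x a) (x b)" and nn: "0 \<le> x a"
    and mult: "x (a * b) = x a * x b" for a b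
    using assms(1) by (auto simp: an_cone_def)
  show "x (p + q) \<le> x p"
    using le[of p q] nn[of p] assms(2) by simp
  have "x (- q) = 0"
    using mult[of "-1" q] assms(2) by simp
  then show "x p \<le> x (p + q)"
    using le[of "p + q" "- q"] nn[of "p + q"] by simp
qed

text \<open>
  Equivalent points can only be compared on homogeneous polynomials. As the kernel is a homogeneous
  ideal, this suffices for vanishing on it.
\<close>

lemma an_rel_vanishing:
  assumes "(x, y) \<in> an_rel nabs" "\<And>p. imm_comorphism f p = 0 \<Longrightarrow> x p = 0"
    and "imm_comorphism f p = 0"
  shows "y p = 0"
proof -
  obtain D g where p: "p = sum g D" and hom: "\<And>d. d \<in> D \<Longrightarrow> homogeneous d (g d)"
    and ker: "\<And>d. d \<in> D \<Longrightarrow> imm_comorphism f (g d) = 0"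
    using kernel_homogeneous_decomposition[OF assms(3)] by blast
  obtain C where y: "y \<in> an_cone nabs" and C: "\<And>d q. homogeneous d q \<Longrightarrow> y q = C ^ d * x q"
    using assms(1) by (auto simp: an_rel_def)
  have "y (g d) = 0" if "d \<in> D" for d
    using C[OF hom[OF that]] assms(2)[OF ker[OF that]] by simp
  then show ?thesis
    unfolding p by (rule an_cone_sum_zero[OF y])
qed

lemma trop_an_class:
  assumes "x \<in> an_cone nabs"
  shows "trop_an (an_rel nabs `` {x}) = trop_rel `` {\<lambda>i. neglog (x (var_mpol i))}"
proof -
  have "trop_rel `` {\<lambda>i. neglog (y (var_mpol i))} = trop_rel `` {\<lambda>i. neglog (x (var_mpol i))}"
    if xy: "(x, y) \<in> an_rel nabs" for y
  proof -
    obtain C where C: "C > 0" "y (var_mpol i) = C * x (var_mpol i)" for i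
      using xy homogeneous_var by (fastforce simp: an_rel_def)
    have "(\<lambda>i. neglog (y (var_mpol i))) = (\<lambda>i. neglog (x (var_mpol i)) + ereal (- ln C))"
      using C assms by (auto simp: neglog_mult an_cone_def)
    then show ?thesis
      using assms by (simp only:) (intro trop_class_shift, auto simp: trop_cone_def an_cone_def)
  qed
  moreover have "(x, x) \<in> an_rel nabs"
    using assms by (auto simp: an_rel_def intro!: exI[of _ 1])
  ultimately show ?thesis
    unfolding trop_an_def by blast
qed

text \<open>
  A point of the analytification of the image of \<open>\<iota>\<close> restricts to a seminorm on the linear forms,
  since linear forms on the source lift to linear polynomials, uniquely up to the kernel.
\<close>

lemma Trop_imp_seminorm:
  assumes f: "linear_immersion f" and p: "p \<in> Trop nabs f"
  obtains s where "s \<in> nontrivial_seminorms nabs" "p = trop_rel `` {trop_lift f s}"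
proof -
  obtain x where x: "x \<in> an_cone nabs" "p = trop_an (an_rel nabs `` {x})"
    and van: "\<And>y q. y \<in> an_rel nabs `` {x} \<Longrightarrow> imm_comorphism f q = 0 \<Longrightarrow> y q = 0"
    using p by (auto simp: Trop_def imm_an_def proj_an_def elim!: quotientE)
  have "(x, x) \<in> an_rel nabs"
    using x by (auto simp: an_rel_def intro!: exI[of _ 1])
  then have van: "x q = 0" if "imm_comorphism f q = 0" for q
    using van that by blast
  define s where "s = (\<lambda>w. x (form_mpol (SOME g. pull_form f g = w)))"
  \<comment> \<open>Two lifts of a linear form differ by an element of the kernel, on which \<open>x\<close> vanishes.\<close>
  have s: "s (pull_form f g) = x (form_mpol g)" for g
  proof -
    define h where "h = (SOME h. pull_form f h = pull_form f g)"
    have h: "pull_form f h = pull_form f g"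
      unfolding h_def by (rule someI) simp
    have "pull_form f (h - g) = 0"
      using h pull_form_add[of f g "h - g"] by simp
    then have "x (form_mpol (h - g)) = 0"
      by (intro van) (simp add: imm_comorphism_form)
    then have "x (form_mpol g + form_mpol (h - g)) = x (form_mpol g)"
      by (rule an_cone_add_vanishing[OF x(1)])
    then have "x (form_mpol h) = x (form_mpol g)"
      by (simp flip: form_mpol_add)
    then show ?thesis
      by (simp add: s_def h_def)
  qed
  have sf: "s (f i) = x (var_mpol i)" for i
    using s[of "axis i 1"] by simp
  have "seminorm nabs s"
    unfolding seminorm_def
  proof (intro conjI allI)
    show "0 \<le> s w" for w
      using x by (simp add: s_def an_cone_def)
    show "s (c *s w) = nabs c * s w" for c w
    proof -
      obtain g where "pull_form f g = w"
        using pull_form_surj[OF f] by blast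
      then show ?thesis
        using s[of "c *s g"] s[of g] x(1)
        by (simp add: pull_form_scale form_mpol_scale an_cone_def)
    qed
    show "s (v + w) \<le> max (s v) (s w)" for v w
    proof -
      obtain g h where "pull_form f g = v" "pull_form f h = w"
        using pull_form_surj[OF f] by metis
      then show ?thesis
        using s[of "g + h"] s[of g] s[of h] x(1)
        by (simp add: pull_form_add form_mpol_add an_cone_def)
    qed
  qed
  moreover have "\<exists>i. s (f i) \<noteq> 0"
    using x(1) by (auto simp: sf an_cone_def)
  ultimately have "s \<in> nontrivial_seminorms nabs"
    by (auto simp: nontrivial_seminorms_def)
  then show ?thesis
    using that x trop_an_class[OF x(1)] by (simp add: trop_lift_def[abs_def] sf)
qed

text \<open>
  Conversely a diagonalizable seminorm extends to a multiplicative one on polynomials, the Gauss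
  norm in the diagonalizing coordinates.
\<close>

lemma diag_seminorm_in_Trop:
  assumes f: "linear_immersion f" and e: "is_basis e" and a: "a \<in> trop_cone"
  shows "trop_rel `` {trop_lift f (diag_seminorm nabs e a)} \<in> Trop nabs f"
proof -
  define c where "c = (\<lambda>i. \<chi> j. coord e (f i) j)"
  define x where "x = (\<lambda>p. gauss_norm nabs (\<lambda>j. expneg (a j)) (imm_comorphism c p))"
  have x_var: "x (var_mpol i) = diag_seminorm nabs e a (f i)" for i
    by (simp add: x_def gauss_norm_form c_def diag_seminorm_def)
  have "\<exists>i. x (var_mpol i) \<noteq> 0"
    using trop_lift_in_trop_cone[OF f diag_seminorm_in_nontrivial[OF e a]]
    by (auto simp: x_var trop_cone_def trop_lift_def)
  then have x: "x \<in> an_cone nabs"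
    by (simp add: an_cone_def x_def imm_comorphism_mult imm_comorphism_add gauss_norm_mult
        gauss_norm_add_le gauss_norm_const gauss_norm_nonneg)
  have van: "x p = 0" if "imm_comorphism f p = 0" for p
  proof -
    \<comment> \<open>The coordinates of \<open>f i\<close> arise from \<open>f i\<close> by a linear substitution, so the kernel for \<open>f\<close>
      lies in the kernel for \<open>c\<close>.\<close>
    define e' where "e' = (\<lambda>j. \<chi> k. coord e (axis j 1) k)"
    have "c = (\<lambda>i. pull_form e' (f i))"
    proof (rule ext, simp add: vec_eq_iff, rule allI)
      fix i k
      have "f i = (\<Sum>j\<in>UNIV. f i $ j *s axis j 1)"
        by (simp add: basis_expansion)
      then have "coord e (f i) k = coord e (\<Sum>j\<in>UNIV. f i $ j *s axis j 1) k"
        by simp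
      also have "\<dots> = (\<Sum>j\<in>UNIV. f i $ j * coord e (axis j 1) k)"
        using e by (subst vec.representation_sum) (auto simp: is_basis_def vec.representation_scale)
      finally show "c i $ k = pull_form e' (f i) $ k"
        by (simp add: c_def e'_def pull_form_nth)
    qed
    then have "imm_comorphism c p = imm_comorphism e' (imm_comorphism f p)"
      by (simp add: imm_comorphism_comp)
    then have "imm_comorphism c p = const_mpol 0"
      using that by simp
    then show ?thesis
      unfolding x_def by (simp only: gauss_norm_const expneg_nonneg) simp
  qed
  have "an_rel nabs `` {x} \<in> imm_an nabs f"
    using x van an_rel_vanishing[of x _ f]
    by (auto simp: imm_an_def proj_an_def intro: quotientI)
  then show ?thesis
    using trop_an_class[OF x] by (auto simp: Trop_def x_var trop_lift_def[abs_def])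
qed

end

section \<open>Determinants of families of linear forms\<close>

lemma is_basis_if_spanning:
  fixes e :: "'m::finite \<Rightarrow> 'k::field^'m"
  assumes "vec.span (range e) = UNIV"
  shows "is_basis e"
proof -
  have dim: "vec.dim (UNIV :: ('k^'m) set) = CARD('m)"
    by (rule vec_dim_card)
  have "card (range e) \<le> CARD('m)"
    by (simp add: card_image_le)
  moreover have "CARD('m) \<le> card (range e)"
    using vec.dim_le_card[of UNIV "range e"] assms dim by simp
  ultimately have card: "card (range e) = CARD('m)"
    by simp
  then have "inj e"
    by (simp add: eq_card_imp_inj_on)
  moreover have "vec.independent (range e)"
    using vec.card_le_dim_spanning[of "range e" UNIV] assms dim card by simp
  ultimately show ?thesis
    using assms by (simp add: is_basis_def)
qed

lemma is_basis_iff_det: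
  fixes e :: "'m::finite \<Rightarrow> 'k::field^'m"
  shows "is_basis e \<longleftrightarrow> det (\<chi> i j. e j $ i) \<noteq> 0"
proof -
  let ?A = "\<chi> i j. e j $ i"
  have "columns ?A = range e"
    by (auto simp: columns_def column_def)
  then have "(\<exists>B. ?A ** B = mat 1) \<longleftrightarrow> vec.span (range e) = UNIV"
    using matrix_right_invertible_span_columns[of ?A] by simp
  also have "\<dots> \<longleftrightarrow> is_basis e"
    using is_basis_if_spanning by (auto simp: is_basis_def)
  finally show ?thesis
    by (simp add: invertible_right_inverse flip: invertible_det_nz)
qed

lemma det_change_of_basis:
  fixes e g :: "'m::finite \<Rightarrow> 'k::field^'m"
  assumes "is_basis e"
  shows "det (\<chi> i j. g j $ i) = det (\<chi> i j. e j $ i) * det (\<chi> j k. coord e (g k) j)"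
proof -
  have "g k $ i = (\<Sum>j\<in>UNIV. e j $ i * coord e (g k) j)" for i k
    by (subst sum_coord[OF assms, of "g k", symmetric]) (simp add: mult.commute)
  then have "(\<chi> i j. g j $ i) = (\<chi> i j. e j $ i) ** (\<chi> j k. coord e (g k) j)"
    by (simp add: matrix_matrix_mult_def vec_eq_iff)
  then show ?thesis
    by (simp add: det_mul)
qed

text \<open>This is Cramer's rule for the column \<open>k\<close>.\<close>

lemma det_exchange:
  fixes e :: "'m::finite \<Rightarrow> 'k::field^'m"
  assumes "is_basis e"
  shows "det (\<chi> i j. (e(k := w)) j $ i) = coord e w k * det (\<chi> i j. e j $ i)"
proof -
  let ?x = "\<chi> j. coord e w j"
  have "((\<chi> i j. e j $ i) *v ?x) $ i = w $ i" for i
    by (subst (2) sum_coord[OF assms, of w, symmetric])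
      (simp add: matrix_vector_mult_def mult.commute)
  then have "(\<chi> i j. (e(k := w)) j $ i)
      = (\<chi> i j. if j = k then ((\<chi> i j. e j $ i) *v ?x) $ i else (\<chi> i j. e j $ i) $ i $ j)"
    by (simp add: vec_eq_iff)
  then show ?thesis
    using cramer_lemma[of k "\<chi> i j. e j $ i" ?x] by simp
qed

context nonarch
begin

text \<open>
  An ultrametric form of Hadamard's inequality: every term of the Leibniz expansion has one factor in
  each row and each column, so the \<open>\<rho> j\<close> and \<open>w k\<close> can be distributed over its factors.
\<close>

lemma nabs_det_le:
  fixes C :: "'k^'m::finite^'m"
  assumes "\<And>j. 0 \<le> \<rho> j" and le: "\<And>j k. nabs (C $ j $ k) * \<rho> j \<le> w k"
  shows "nabs (det C) * (\<Prod>j\<in>UNIV. \<rho> j) \<le> (\<Prod>k\<in>UNIV. w k)"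
proof -
  have w: "0 \<le> w k" for k
    using le[of undefined k] assms(1)[of undefined] nabs_nonneg
    by (meson mult_nonneg_nonneg order_trans)
  show ?thesis
  proof (cases "(\<Prod>j\<in>UNIV. \<rho> j) = 0")
    case True
    then show ?thesis
      by (simp only: mult_zero_right) (simp add: prod_nonneg w)
  next
    case False
    then have pos: "0 < (\<Prod>j\<in>UNIV. \<rho> j)"
      using assms(1) by (simp add: less_le prod_nonneg)
    have "nabs (det C) \<le> (\<Prod>k\<in>UNIV. w k) / (\<Prod>j\<in>UNIV. \<rho> j)"
      unfolding det_def
    proof (intro nabs_sum_le)
      show "0 \<le> (\<Prod>k\<in>UNIV. w k) / (\<Prod>j\<in>UNIV. \<rho> j)"
        using pos by (simp add: prod_nonneg w)
      fix p :: "'m \<Rightarrow> 'm" assume "p \<in> {p. p permutes UNIV}"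
      then have p: "p permutes UNIV"
        by simp
      have "nabs (of_int (sign p)) = 1"
        by (cases p rule: sign_cases) (simp_all add: nabs_minus_one)
      then have "nabs (of_int (sign p) * (\<Prod>i\<in>UNIV. C $ i $ p i)) * (\<Prod>j\<in>UNIV. \<rho> j)
          = (\<Prod>i\<in>UNIV. nabs (C $ i $ p i) * \<rho> i)"
        by (simp add: nabs_mult nabs_prod prod.distrib)
      also have "\<dots> \<le> (\<Prod>i\<in>UNIV. w (p i))"
        by (intro prod_mono) (auto simp: le assms(1) nabs_nonneg)
      also have "\<dots> = (\<Prod>i\<in>UNIV. w i)"
        using prod.permute[OF p, of w] by (simp add: o_def)
      finally show "nabs (of_int (sign p) * (\<Prod>i\<in>UNIV. C $ i $ p i))
          \<le> (\<Prod>k\<in>UNIV. w k) / (\<Prod>j\<in>UNIV. \<rho> j)"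
        using pos by (simp add: pos_le_divide_eq)
    qed
    then show ?thesis
      using pos by (simp add: pos_le_divide_eq)
  qed
qed

lemma nabs_det_le_basis:
  fixes e g :: "'m::finite \<Rightarrow> 'k^'m"
  assumes "is_basis e" "\<And>j. 0 \<le> \<rho> j" "\<And>j k. nabs (coord e (g k) j) * \<rho> j \<le> w k"
  shows "nabs (det (\<chi> i j. g j $ i)) * (\<Prod>j\<in>UNIV. \<rho> j)
    \<le> nabs (det (\<chi> i j. e j $ i)) * (\<Prod>k\<in>UNIV. w k)"
proof -
  let ?C = "\<chi> j k. coord e (g k) j" and ?E = "nabs (det (\<chi> i j. e j $ i))"
  have "nabs (det ?C) * (\<Prod>j\<in>UNIV. \<rho> j) \<le> (\<Prod>k\<in>UNIV. w k)"
    by (rule nabs_det_le) (simp_all add: assms(2,3))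
  then have "?E * (nabs (det ?C) * (\<Prod>j\<in>UNIV. \<rho> j)) \<le> ?E * (\<Prod>k\<in>UNIV. w k)"
    by (rule mult_left_mono[OF _ nabs_nonneg])
  then show ?thesis
    by (simp add: det_change_of_basis[OF assms(1), of g] nabs_mult mult.assoc)
qed

end


section \<open>Bases of the initial matroid\<close>

locale immersion = nonarch nabs for nabs :: "'k::field \<Rightarrow> real" +
  fixes f :: "'n::finite \<Rightarrow> 'k^'r::finite"
  assumes f: "linear_immersion f"
begin

definition base_det :: "('r \<Rightarrow> 'n) \<Rightarrow> real" where
  "base_det \<sigma> = nabs (det (\<chi> i j. f (\<sigma> j) $ i))"

lemma base_det_eq_0_iff: "base_det \<sigma> = 0 \<longleftrightarrow> \<not> is_basis (f \<circ> \<sigma>)"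
  by (simp add: base_det_def is_basis_iff_det)

lemma base_det_nonneg: "0 \<le> base_det \<sigma>"
  by (simp add: base_det_def nabs_nonneg)

lemma base_det_le:
  assumes "is_basis (f \<circ> \<sigma>)" "\<And>j. 0 \<le> \<rho> j"
    and "\<And>j k. nabs (coord (f \<circ> \<sigma>) (f (\<tau> k)) j) * \<rho> j \<le> w k"
  shows "base_det \<tau> * (\<Prod>j\<in>UNIV. \<rho> j) \<le> base_det \<sigma> * (\<Prod>k\<in>UNIV. w k)"
  using nabs_det_le_basis[of "f \<circ> \<sigma>" \<rho> "f \<circ> \<tau>" w] assms by (simp add: base_det_def)

text \<open>
  Two enumerations of the same set are related by a change of basis with entries \<open>0\<close> and \<open>1\<close>.
\<close>

lemma base_det_range_le:
  assumes "range \<tau> = range \<sigma>"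
  shows "base_det \<tau> \<le> base_det \<sigma>"
proof (cases "is_basis (f \<circ> \<sigma>)")
  case True
  have "nabs (coord (f \<circ> \<sigma>) (f (\<tau> k)) j) * 1 \<le> 1" for j k
  proof -
    obtain l where "\<tau> k = \<sigma> l"
      using assms by (metis rangeE rangeI)
    then show ?thesis
      using coord_basis[OF True, of l j] by simp
  qed
  then show ?thesis
    using base_det_le[OF True, of "\<lambda>_. 1" \<tau> "\<lambda>_. 1"] by simp
next
  case False
  have "range (f \<circ> \<tau>) = range (f \<circ> \<sigma>)"
    using assms by (metis image_comp)
  then have "\<not> is_basis (f \<circ> \<tau>)"
    using False is_basis_if_spanning[of "f \<circ> \<sigma>"] by (metis is_basis_def)
  then show ?thesis
    using base_det_eq_0_iff base_det_nonneg by metis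
qed

lemma det_val_range:
  assumes "inj \<sigma>"
  shows "det_val nabs f (range \<sigma>) = neglog (base_det \<sigma>)"
proof -
  define \<tau> where "\<tau> = (SOME \<tau>. bij_betw \<tau> (UNIV :: 'r set) (range \<sigma>))"
  have "bij_betw \<tau> UNIV (range \<sigma>)"
    unfolding \<tau>_def by (rule someI[of _ \<sigma>]) (simp add: assms inj_on_imp_bij_betw)
  then have "range \<tau> = range \<sigma>"
    by (simp add: bij_betw_def)
  then have "base_det \<tau> = base_det \<sigma>"
    using base_det_range_le by (metis antisym)
  then show ?thesis
    by (simp add: det_val_def \<tau>_def[symmetric] Let_def base_det_def)
qed

text \<open>
  This is \<open>expneg\<close> of the quantity \<open>v(B) - (\<Sum>b\<in>B. u b)\<close> which the bases of the initial matroid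
  minimize; compare \<open>neglog_base_weight\<close>. Being a real number, it can be computed with even where
  \<open>v(B)\<close> is infinite.
\<close>

definition base_weight :: "('n \<Rightarrow> ereal) \<Rightarrow> ('r \<Rightarrow> 'n) \<Rightarrow> real" where
  "base_weight u \<sigma> = base_det \<sigma> / (\<Prod>j\<in>UNIV. expneg (u (\<sigma> j)))"

text \<open>
  Enumerations of the candidate bases; an enumeration gives access to the columns of the determinant
  and to the elements of a basis of linear forms.
\<close>

definition candidates :: "('r \<Rightarrow> 'n) set" where
  "candidates = {\<sigma>. inj \<sigma> \<and> (\<forall>j. f (\<sigma> j) \<noteq> 0)}"

lemma candidate_bases_eq: "candidate_bases f = range ` candidates"
proof (intro equalityI subsetI)
  fix B assume B: "B \<in> candidate_bases f"
  then obtain \<sigma> :: "'r \<Rightarrow> 'n" where "bij_betw \<sigma> UNIV B"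
    using finite_same_card_bij[of "UNIV :: 'r set" B] by (auto simp: candidate_bases_def)
  then show "B \<in> range ` candidates"
    using B by (auto simp: bij_betw_def candidates_def candidate_bases_def)
next
  fix B assume "B \<in> range ` candidates"
  then show "B \<in> candidate_bases f"
    by (auto simp: candidates_def candidate_bases_def card_image)
qed

lemma basis_candidate: "is_basis (f \<circ> \<sigma>) \<Longrightarrow> \<sigma> \<in> candidates"
  using basis_nonzero[of "f \<circ> \<sigma>"] by (auto simp: candidates_def is_basis_def dest: inj_on_imageI2)

lemma neglog_base_weight:
  assumes u: "finite_lift f u" and \<sigma>: "\<sigma> \<in> candidates"
  shows "det_val nabs f (range \<sigma>) - (\<Sum>b\<in>range \<sigma>. u b) = neglog (base_weight u \<sigma>)"
proof -
  have inj: "inj \<sigma>" and nz: "f (\<sigma> j) \<noteq> 0" for j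
    using \<sigma> by (auto simp: candidates_def)
  define U where "U = (\<lambda>j. real_of_ereal (u (\<sigma> j)))"
  have U: "u (\<sigma> j) = ereal (U j)" for j
    using u nz[of j] unfolding finite_lift_def trop_cone_def U_def
    by (cases "u (\<sigma> j)") auto
  have "(\<Sum>b\<in>range \<sigma>. u b) = ereal (\<Sum>j\<in>UNIV. U j)"
    by (simp add: sum.reindex[OF inj] U)
  moreover have "base_weight u \<sigma> = exp (\<Sum>j\<in>UNIV. U j) * base_det \<sigma>"
    by (simp add: base_weight_def U exp_minus exp_sum prod_inversef[symmetric] prod_dividef field_simps)
  ultimately show ?thesis
    by (simp add: det_val_range[OF inj] neglog_mult base_det_nonneg minus_ereal_def)
qed

lemma base_weight_nonneg: "0 \<le> base_weight u \<sigma>"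
  by (simp add: base_weight_def base_det_nonneg prod_nonneg)

text \<open>As \<open>neglog\<close> reverses the order, minimizing becomes maximizing a nonnegative real number.\<close>

lemma initial_matroid_eq:
  assumes "finite_lift f u"
  shows "initial_matroid nabs f u
    = range ` {\<sigma> \<in> candidates. \<forall>\<tau>\<in>candidates. base_weight u \<tau> \<le> base_weight u \<sigma>}"
proof -
  have "neglog (base_weight u \<sigma>) \<le> neglog (base_weight u \<tau>) \<longleftrightarrow> base_weight u \<tau> \<le> base_weight u \<sigma>"
    for \<sigma> \<tau>
    using neglog_less_iff[OF base_weight_nonneg base_weight_nonneg, of u \<tau> u \<sigma>]
    by (simp add: linorder_not_less[symmetric])
  then show ?thesis
    unfolding initial_matroid_def candidate_bases_eq
    by (auto simp: neglog_base_weight[OF assms] image_iff)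
qed

lemma exists_basis: "\<exists>\<sigma>. is_basis (f \<circ> \<sigma>)"
proof -
  obtain B where B: "B \<subseteq> range f" "vec.independent B" "range f \<subseteq> vec.span B"
    using vec.maximal_independent_subset[of "range f"] by blast
  have "vec.span (range f) \<subseteq> vec.span B"
    using B(3) by (simp add: vec.span_minimal vec.subspace_span)
  then have span: "vec.span B = UNIV"
    using f by (auto simp: linear_immersion_def)
  have fin: "finite B"
    by (rule finite_subset[OF B(1)]) simp
  have "card B = CARD('r)"
    using vec.dim_eq_card[of B UNIV] B(2) span vec_dim_card by (metis vec.span_UNIV)
  then obtain h :: "'r \<Rightarrow> 'k^'r" where h: "bij_betw h UNIV B"
    using finite_same_card_bij[of "UNIV :: 'r set" B] fin by auto
  then have "h j \<in> range f" for j
    using B(1) by (auto simp: bij_betw_def)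
  then have "\<forall>j. \<exists>i. f i = h j"
    by (metis rangeE)
  then obtain \<sigma> where "\<forall>j. f (\<sigma> j) = h j"
    by metis
  then have "f \<circ> \<sigma> = h"
    by auto
  moreover have "is_basis h"
    using h span by (intro is_basis_if_spanning) (simp add: bij_betw_def)
  ultimately show ?thesis
    by blast
qed

lemma initial_matroid_basis:
  assumes u: "finite_lift f u" and "range \<sigma> \<in> initial_matroid nabs f u" "inj \<sigma>"
  shows "is_basis (f \<circ> \<sigma>)" "\<And>\<tau>. \<tau> \<in> candidates \<Longrightarrow> base_weight u \<tau> \<le> base_weight u \<sigma>"
proof -
  obtain \<sigma>' where \<sigma>': "\<sigma>' \<in> candidates" "range \<sigma> = range \<sigma>'"
    and max': "\<And>\<tau>. \<tau> \<in> candidates \<Longrightarrow> base_weight u \<tau> \<le> base_weight u \<sigma>'"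
    using assms(2) by (auto simp: initial_matroid_eq[OF u])
  have "f (\<sigma> j) \<noteq> 0" for j
  proof -
    obtain l where "\<sigma> j = \<sigma>' l"
      using \<sigma>'(2) by blast
    then show ?thesis
      using \<sigma>'(1) by (simp add: candidates_def)
  qed
  then have \<sigma>: "\<sigma> \<in> candidates"
    using assms(3) by (simp add: candidates_def)
  have "neglog (base_weight u \<sigma>) = neglog (base_weight u \<sigma>')"
    using neglog_base_weight[OF u \<sigma>] neglog_base_weight[OF u \<sigma>'(1)] \<sigma>'(2) by simp
  then have "base_weight u \<sigma> = base_weight u \<sigma>'"
    by (metis base_weight_nonneg expneg_neglog)
  with max' show max: "base_weight u \<tau> \<le> base_weight u \<sigma>" if "\<tau> \<in> candidates" for \<tau>
    using that by simp
  obtain \<tau> where \<tau>: "is_basis (f \<circ> \<tau>)"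
    using exists_basis by blast
  have pos: "expneg (u (\<tau> j)) \<noteq> 0" for j
    using u basis_nonzero[OF \<tau>, of j] by (simp add: finite_lift_def)
  have "base_weight u \<tau> \<noteq> 0"
    using pos \<tau> by (simp add: base_weight_def base_det_eq_0_iff)
  then have "base_weight u \<sigma> \<noteq> 0"
    using max[OF basis_candidate[OF \<tau>]] base_weight_nonneg[of u \<tau>] by simp
  then show "is_basis (f \<circ> \<sigma>)"
    by (auto simp: base_weight_def base_det_eq_0_iff)
qed

lemma initial_matroid_nonempty:
  assumes "finite_lift f u"
  shows "\<exists>\<sigma> :: 'r \<Rightarrow> 'n. inj \<sigma> \<and> range \<sigma> \<in> initial_matroid nabs f u"
proof -
  have "candidates \<noteq> {}"
    using exists_basis basis_candidate by blast
  then have "Max (base_weight u ` candidates) \<in> base_weight u ` candidates"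
    by (intro Max_in) auto
  then obtain \<sigma> where "\<sigma> \<in> candidates" "base_weight u \<sigma> = Max (base_weight u ` candidates)"
    by auto
  then have "\<sigma> \<in> {\<sigma> \<in> candidates. \<forall>\<tau>\<in>candidates. base_weight u \<tau> \<le> base_weight u \<sigma>}"
    by auto
  then have "range \<sigma> \<in> initial_matroid nabs f u" "inj \<sigma>"
    unfolding initial_matroid_eq[OF assms] by (blast, simp add: candidates_def)
  then show ?thesis
    by blast
qed

section \<open>Charts of the tropicalization\<close>

text \<open>
  The points whose coordinates are determined by those at \<open>\<sigma>\<close> through the diagonal seminorm of
  \<open>f \<circ> \<sigma>\<close>. If this is a basis, it means for finite points that \<open>\<sigma>\<close> enumerates a basis of the
  initial matroid and that the point lies in the tropicalization; in this form the condition is closed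
  and makes sense at infinite coordinates.
\<close>

definition chart :: "('r \<Rightarrow> 'n) \<Rightarrow> ('n \<Rightarrow> ereal) set" where
  "chart \<sigma> = {u \<in> trop_cone. \<forall>i. expneg (u i) = diag_seminorm nabs (f \<circ> \<sigma>) (u \<circ> \<sigma>) (f i)}"

lemma chart_subset: "chart \<sigma> \<subseteq> trop_cone"
  by (auto simp: chart_def)

lemma trop_lift_chart:
  assumes "u \<in> chart \<sigma>"
  shows "trop_lift f (diag_seminorm nabs (f \<circ> \<sigma>) (u \<circ> \<sigma>)) = u"
proof
  fix i
  have "u i \<noteq> -\<infinity>" "expneg (u i) = diag_seminorm nabs (f \<circ> \<sigma>) (u \<circ> \<sigma>) (f i)"
    using assms by (auto simp: chart_def trop_cone_def)
  then show "trop_lift f (diag_seminorm nabs (f \<circ> \<sigma>) (u \<circ> \<sigma>)) i = u i"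
    by (simp add: trop_lift_def flip: \<open>expneg (u i) = _\<close>)
qed

text \<open>
  If the weights on the basis were all infinite, the diagonal seminorm would vanish at every \<open>f i\<close>.
\<close>

lemma chart_restrict:
  assumes "u \<in> chart \<sigma>"
  shows "u \<circ> \<sigma> \<in> trop_cone"
proof (rule ccontr)
  assume "u \<circ> \<sigma> \<notin> trop_cone"
  then have "u (\<sigma> j) = \<infinity>" for j
    using assms by (auto simp: chart_def trop_cone_def)
  then have "diag_seminorm nabs (f \<circ> \<sigma>) (u \<circ> \<sigma>) w = 0" for w
    by (simp add: diag_seminorm_def)
  then have "u i = \<infinity>" for i
    using assms by (auto simp: chart_def)
  then show False
    using assms by (auto simp: chart_def trop_cone_def)
qed

text \<open>
  The weights on the basis are free parameters for the points of the chart.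
\<close>

lemma trop_lift_in_chart:
  assumes \<sigma>: "is_basis (f \<circ> \<sigma>)" and a: "a \<in> trop_cone"
  shows "trop_lift f (diag_seminorm nabs (f \<circ> \<sigma>) a) \<in> chart \<sigma>"
    and "trop_lift f (diag_seminorm nabs (f \<circ> \<sigma>) a) \<circ> \<sigma> = a"
proof -
  let ?u = "trop_lift f (diag_seminorm nabs (f \<circ> \<sigma>) a)"
  show restrict: "?u \<circ> \<sigma> = a"
  proof
    fix j
    have "a j \<noteq> -\<infinity>"
      using a by (simp add: trop_cone_def)
    then show "(?u \<circ> \<sigma>) j = a j"
      using diag_seminorm_basis[OF \<sigma>, of a j] by (simp add: trop_lift_def)
  qed
  have "?u \<in> trop_cone"
    by (rule trop_lift_in_trop_cone[OF f diag_seminorm_in_nontrivial[OF \<sigma> a]])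
  moreover have "expneg (?u i) = diag_seminorm nabs (f \<circ> \<sigma>) (?u \<circ> \<sigma>) (f i)" for i
    unfolding restrict by (simp add: trop_lift_def diag_seminorm_nonneg)
  ultimately show "?u \<in> chart \<sigma>"
    by (simp add: chart_def)
qed

lemma chart_shift:
  assumes "u \<in> chart \<sigma>"
  shows "(\<lambda>i. u i + ereal c) \<in> chart \<sigma>"
    and "diag_seminorm nabs (f \<circ> \<sigma>) ((\<lambda>i. u i + ereal c) \<circ> \<sigma>) w
      = exp (- c) * diag_seminorm nabs (f \<circ> \<sigma>) (u \<circ> \<sigma>) w"
proof -
  have u: "u i \<noteq> -\<infinity>" for i
    using assms by (auto simp: chart_def trop_cone_def)
  then show *: "diag_seminorm nabs (f \<circ> \<sigma>) ((\<lambda>i. u i + ereal c) \<circ> \<sigma>) w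
      = exp (- c) * diag_seminorm nabs (f \<circ> \<sigma>) (u \<circ> \<sigma>) w" for w
    using diag_seminorm_shift[of "u \<circ> \<sigma>" nabs "f \<circ> \<sigma>" c w] by (simp add: o_def)
  have "expneg (u i + ereal c) = diag_seminorm nabs (f \<circ> \<sigma>) ((\<lambda>i. u i + ereal c) \<circ> \<sigma>) (f i)" for i
    unfolding * using assms by (simp add: expneg_shift u chart_def)
  then show "(\<lambda>i. u i + ereal c) \<in> chart \<sigma>"
    using assms trop_cone_shift[of u c] by (simp add: chart_def)
qed

text \<open>
  Both seminorms are the largest one with value at most \<open>expneg (u i)\<close> at \<open>f i\<close> for all \<open>i\<close>.
\<close>

lemma chart_agree:
  assumes "is_basis (f \<circ> \<sigma>)" "u \<in> chart \<sigma>" "is_basis (f \<circ> \<tau>)" "u \<in> chart \<tau>"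
  shows "diag_seminorm nabs (f \<circ> \<sigma>) (u \<circ> \<sigma>) = diag_seminorm nabs (f \<circ> \<tau>) (u \<circ> \<tau>)"
proof -
  have "diag_seminorm nabs (f \<circ> \<sigma>) (u \<circ> \<sigma>) w \<le> diag_seminorm nabs (f \<circ> \<tau>) (u \<circ> \<tau>) w"
    if "is_basis (f \<circ> \<sigma>)" "u \<in> chart \<sigma>" "is_basis (f \<circ> \<tau>)" for w \<sigma> \<tau>
    by (rule seminorm_le_diag_seminorm[OF that(3) seminorm_diag_seminorm[OF that(1)]])
      (use that(2) in \<open>simp add: chart_def\<close>)
  then show ?thesis
    using assms by (intro ext antisym) auto
qed

lemma closedin_chart: "closedin (top_of_set trop_cone) (chart \<sigma>)"
proof -
  have "continuous_on trop_cone (\<lambda>u. expneg (u i) - diag_seminorm nabs (f \<circ> \<sigma>) (u \<circ> \<sigma>) (f i))" for i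
    by (intro continuous_intros continuous_on_diag_seminorm)
      (simp_all add: continuous_on_expneg_coordinate)
  then have "closedin (top_of_set trop_cone)
      (trop_cone \<inter> (\<lambda>u. expneg (u i) - diag_seminorm nabs (f \<circ> \<sigma>) (u \<circ> \<sigma>) (f i)) -` {0})" for i
    by (intro continuous_closedin_preimage) auto
  then have "closedin (top_of_set trop_cone)
      (\<Inter>i. trop_cone \<inter> (\<lambda>u. expneg (u i) - diag_seminorm nabs (f \<circ> \<sigma>) (u \<circ> \<sigma>) (f i)) -` {0})"
    by (intro closedin_INT) auto
  also have "(\<Inter>i. trop_cone \<inter> (\<lambda>u. expneg (u i) - diag_seminorm nabs (f \<circ> \<sigma>) (u \<circ> \<sigma>) (f i)) -` {0})
      = chart \<sigma>"
    by (auto simp: chart_def)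
  finally show ?thesis .
qed

text \<open>
  If \<open>\<sigma>\<close> enumerates a basis of the initial matroid, no exchange increases \<open>base_weight\<close>, and
  by Cramer's rule this bounds the coordinates of every \<open>f i\<close>.
\<close>

lemma initial_matroid_imp_chart:
  assumes s: "s \<in> nontrivial_seminorms nabs" and u: "finite_lift f (trop_lift f s)"
    and \<sigma>: "inj \<sigma>" "range \<sigma> \<in> initial_matroid nabs f (trop_lift f s)"
  shows "is_basis (f \<circ> \<sigma>)" "trop_lift f s \<in> chart \<sigma>"
proof -
  let ?u = "trop_lift f s"
  have sn: "seminorm nabs s"
    using s by (simp add: nontrivial_seminorms_def)
  have w: "expneg (?u i) = s (f i)" for i
    using sn by (simp add: trop_lift_def seminorm_def)
  have basis: "is_basis (f \<circ> \<sigma>)"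
    and max: "\<And>\<tau>. \<tau> \<in> candidates \<Longrightarrow> base_weight ?u \<tau> \<le> base_weight ?u \<sigma>"
    using initial_matroid_basis[OF u \<sigma>(2,1)] by auto
  show "is_basis (f \<circ> \<sigma>)"
    by (rule basis)
  have nonneg: "0 \<le> s v" for v
    using sn by (simp add: seminorm_def)
  have pos: "0 < s (f i)" if "f i \<noteq> 0" for i
    using that u nonneg by (auto simp: finite_lift_def trop_lift_def less_le)
  have coord_le: "nabs (coord (f \<circ> \<sigma>) (f i) k) * s (f (\<sigma> k)) \<le> s (f i)" for i k
  proof (cases "coord (f \<circ> \<sigma>) (f i) k = 0")
    case True
    then show ?thesis
      by (simp add: nonneg)
  next
    case False
    let ?c = "coord (f \<circ> \<sigma>) (f i) k"
    have "coord (f \<circ> \<sigma>) 0 k = 0"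
      using coord_scale[OF basis, of 0 0 k] by simp
    then have fi: "f i \<noteq> 0"
      using False by auto
    show ?thesis
    proof (cases "i \<in> range \<sigma>")
      case True
      then obtain l where l: "i = \<sigma> l"
        by blast
      then show ?thesis
        using coord_basis[OF basis, of l k] nonneg by (auto split: if_splits)
    next
      case i: False
      let ?\<tau> = "\<sigma>(k := i)"
      have "inj ?\<tau>"
        using \<sigma>(1) i by (auto simp: inj_on_def)
      then have "?\<tau> \<in> candidates"
        using basis_candidate[OF basis] fi by (auto simp: candidates_def)
      then have le: "base_weight ?u ?\<tau> \<le> base_weight ?u \<sigma>"
        by (rule max)
      have det: "base_det ?\<tau> = nabs ?c * base_det \<sigma>"
        using det_exchange[OF basis, of k "f i"]
        by (simp add: base_det_def fun_upd_def if_distrib[of f] nabs_mult[symmetric] cong: if_cong)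
      define R where "R = (\<Prod>j\<in>UNIV - {k}. s (f (\<sigma> j)))"
      have R: "0 < R"
        unfolding R_def using basis_nonzero[OF basis] by (intro prod_pos) (auto intro: pos)
      have D: "0 < base_det \<sigma>"
        using base_det_nonneg[of \<sigma>] base_det_eq_0_iff[of \<sigma>] basis by (simp add: less_le)
      have sk: "0 < s (f (\<sigma> k))"
        using basis_nonzero[OF basis, of k] by (intro pos) simp
      have "(\<Prod>j\<in>UNIV. s (f (\<sigma> j))) = s (f (\<sigma> k)) * R"
        unfolding R_def by (rule prod.remove) auto
      moreover have "(\<Prod>j\<in>UNIV. s (f (?\<tau> j))) = s (f i) * (\<Prod>j\<in>UNIV - {k}. s (f (?\<tau> j)))"
        using prod.remove[of UNIV k "\<lambda>j. s (f (?\<tau> j))"] by simp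
      moreover have "(\<Prod>j\<in>UNIV - {k}. s (f (?\<tau> j))) = R"
        unfolding R_def by (intro prod.cong) auto
      ultimately have "nabs ?c * base_det \<sigma> / (s (f i) * R) \<le> base_det \<sigma> / (s (f (\<sigma> k)) * R)"
        using le unfolding base_weight_def w det by simp
      then have "nabs ?c * s (f (\<sigma> k)) * (base_det \<sigma> * R) \<le> s (f i) * (base_det \<sigma> * R)"
        using pos[OF fi] sk R by (simp add: frac_le_eq divide_le_eq pos_divide_le_eq field_simps)
      then show ?thesis
        using D R by simp
    qed
  qed
  have "expneg (?u i) = diag_seminorm nabs (f \<circ> \<sigma>) (?u \<circ> \<sigma>) (f i)" for i
  proof (rule antisym)
    show "expneg (?u i) \<le> diag_seminorm nabs (f \<circ> \<sigma>) (?u \<circ> \<sigma>) (f i)"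
      unfolding w by (rule seminorm_le_diag_seminorm[OF basis sn]) (simp add: w)
    show "diag_seminorm nabs (f \<circ> \<sigma>) (?u \<circ> \<sigma>) (f i) \<le> expneg (?u i)"
      unfolding diag_seminorm_le_iff w using coord_le by (simp add: w)
  qed
  then show "?u \<in> chart \<sigma>"
    using trop_lift_in_trop_cone[OF f s] by (simp add: chart_def)
qed

text \<open>
  Conversely, in a chart the coordinates of every \<open>f i\<close> with respect to the basis are bounded, and
  Hadamard's inequality turns this into a bound for all determinants.
\<close>

lemma chart_imp_initial_matroid:
  assumes u: "finite_lift f u" and \<sigma>: "is_basis (f \<circ> \<sigma>)" "u \<in> chart \<sigma>"
  shows "range \<sigma> \<in> initial_matroid nabs f u"
proof -
  have pos: "0 < (\<Prod>j\<in>UNIV. expneg (u (\<tau> j)))" if "\<tau> \<in> candidates" for \<tau>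
    using that u by (intro prod_pos) (auto simp: candidates_def finite_lift_def less_le)
  have "base_weight u \<tau> \<le> base_weight u \<sigma>" if \<tau>: "\<tau> \<in> candidates" for \<tau>
  proof -
    have "nabs (coord (f \<circ> \<sigma>) (f (\<tau> k)) j) * expneg (u (\<sigma> j)) \<le> expneg (u (\<tau> k))" for j k
      using \<sigma>(2) le_diag_seminorm[of nabs "f \<circ> \<sigma>" "f (\<tau> k)" j "u \<circ> \<sigma>"] by (simp add: chart_def)
    then have "base_det \<tau> * (\<Prod>j\<in>UNIV. expneg (u (\<sigma> j))) \<le> base_det \<sigma> * (\<Prod>j\<in>UNIV. expneg (u (\<tau> j)))"
      by (intro base_det_le[OF \<sigma>(1)]) auto
    then show ?thesis
      using pos[OF \<tau>] pos[OF basis_candidate[OF \<sigma>(1)]]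
      by (simp add: base_weight_def frac_le_eq pos_divide_le_eq pos_le_divide_eq field_simps)
  qed
  then show ?thesis
    using basis_candidate[OF \<sigma>(1)] by (auto simp: initial_matroid_eq[OF u])
qed

lemma continuous_on_trop_lift:
  assumes "\<And>i. continuous_on S (\<lambda>x. s x (f i))" "\<And>x i. x \<in> S \<Longrightarrow> 0 \<le> s x (f i)"
  shows "continuous_on S (\<lambda>x. trop_lift f (s x))"
  unfolding trop_lift_def
  by (intro continuous_on_coordinatewise_then_product continuous_on_compose2[OF continuous_on_neglog])
    (use assms in auto)

lemma closedin_trop_cone_limit:
  fixes g :: "real \<Rightarrow> 'n \<Rightarrow> ereal"
  assumes "closedin (top_of_set trop_cone) F" "continuous_on {0..} g"
    and "\<And>t. 0 < t \<Longrightarrow> g t \<in> F" "g 0 \<in> trop_cone"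
  shows "g 0 \<in> F"
proof -
  obtain T where T: "closed T" "F = trop_cone \<inter> T"
    using assms(1) by (auto simp: closedin_closed)
  have "g ` closure {0<..} \<subseteq> T"
    using assms(2,3) T by (intro image_closure_subset) auto
  then show ?thesis
    using T assms(4) by auto
qed

text \<open>
  For a norm the initial matroid provides a chart. A seminorm is the limit of its maximum with
  small multiples of a fixed norm, and the union of the finitely many charts is closed.
\<close>

lemma trop_lift_in_some_chart:
  assumes s: "s \<in> nontrivial_seminorms nabs"
  shows "\<exists>\<sigma>. is_basis (f \<circ> \<sigma>) \<and> trop_lift f s \<in> chart \<sigma>"
proof -
  obtain \<sigma> where \<sigma>: "is_basis (f \<circ> \<sigma>)"
    using exists_basis by blast
  have sn: "seminorm nabs s"
    using s by (simp add: nontrivial_seminorms_def)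
  define N where "N = (\<lambda>t. diag_seminorm nabs (f \<circ> \<sigma>) (\<lambda>_. neglog t))"
  define S where "S = (\<lambda>t w. max (s w) (N t w))"
  let ?F = "\<Union>\<sigma>\<in>{\<sigma>. is_basis (f \<circ> \<sigma>)}. chart \<sigma>"
  have N: "seminorm nabs (N t)" for t
    unfolding N_def by (rule seminorm_diag_seminorm[OF \<sigma>])
  have S: "seminorm nabs (S t)" for t
    unfolding seminorm_def
  proof (intro conjI allI)
    show "0 \<le> S t w" for w
      using sn by (simp add: S_def seminorm_def le_max_iff_disj)
    show "S t (c *s w) = nabs c * S t w" for c w
      using sn N[of t] by (simp add: S_def seminorm_def max_mult_distrib_left nabs_nonneg)
    show "S t (v + w) \<le> max (S t v) (S t w)" for v w
    proof -
      have "s (v + w) \<le> max (s v) (s w)" "N t (v + w) \<le> max (N t v) (N t w)"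
        using sn N[of t] by (simp_all add: seminorm_def)
      then show ?thesis
        unfolding S_def by linarith
    qed
  qed
  have nontriv: "S t \<in> nontrivial_seminorms nabs" for t
  proof -
    obtain w where "s w \<noteq> 0"
      using s by (auto simp: nontrivial_seminorms_def)
    then have "0 < s w"
      using sn by (simp add: seminorm_def less_le)
    then have "S t w \<noteq> 0"
      by (simp add: S_def max_def)
    then show ?thesis
      using S by (auto simp: nontrivial_seminorms_def)
  qed
  have "trop_lift f (S 0) \<in> ?F"
  proof (rule closedin_trop_cone_limit)
    show "closedin (top_of_set trop_cone) ?F"
      by (intro closedin_Union) (auto simp: closedin_chart)
    have "continuous_on {0..} (\<lambda>t. N t w)" for w
      unfolding N_def by (rule continuous_on_diag_seminorm)
        (auto intro: continuous_on_eq[OF continuous_on_id])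
    then show "continuous_on {0..} (\<lambda>t. trop_lift f (S t))"
      using S by (intro continuous_on_trop_lift) (auto simp: S_def seminorm_def intro: continuous_on_max)
    show "trop_lift f (S 0) \<in> trop_cone"
      by (rule trop_lift_in_trop_cone[OF f nontriv])
    fix t :: real assume t: "0 < t"
    have "N t w = 0 \<longleftrightarrow> w = 0" for w
      unfolding N_def using t by (intro diag_seminorm_eq_0_iff[OF \<sigma>]) simp
    moreover have "0 \<le> N t w" "0 \<le> s w" for w
      using N[of t] sn by (simp_all add: seminorm_def)
    ultimately have "S t w = 0 \<longleftrightarrow> w = 0" for w
      using seminorm_0[OF sn] unfolding S_def by (metis max.absorb1 max.cobounded2 order_antisym)
    then have "finite_lift f (trop_lift f (S t))"
      using trop_lift_in_trop_cone[OF f nontriv[of t]] by (simp add: finite_lift_def trop_lift_def)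
    then show "trop_lift f (S t) \<in> ?F"
      using initial_matroid_nonempty initial_matroid_imp_chart[OF nontriv] by blast
  qed
  moreover have "N 0 w = 0" for w
    by (simp add: N_def diag_seminorm_def)
  then have "S 0 = s"
    using sn by (simp add: S_def seminorm_def max_absorb1)
  ultimately show ?thesis
    by auto
qed

text \<open>
  Raising the sizes of the basis elements to at least \<open>t > 0\<close> makes all weights on the basis finite,
  and the diagonal seminorm depends continuously on \<open>t\<close>.
\<close>

lemma chart_approximation:
  assumes \<sigma>: "is_basis (f \<circ> \<sigma>)" and u: "u \<in> chart \<sigma>"
  shows "\<exists>g. continuous_on {0..} g \<and> g (0 :: real) = u \<and>
    (\<forall>t>0. g t \<in> chart \<sigma> \<and> finite_lift f (g t))"
proof -
  define a where "a = (\<lambda>t j. neglog (max (expneg (u (\<sigma> j))) t))"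
  let ?g = "\<lambda>t. trop_lift f (diag_seminorm nabs (f \<circ> \<sigma>) (a t))"
  have "expneg (a t j) = max (expneg (u (\<sigma> j))) t" for t j
    by (simp add: a_def le_max_iff_disj)
  then have "continuous_on {0..} (\<lambda>t. expneg (a t j))" for j
    by (auto intro!: continuous_intros)
  then have cont: "continuous_on {0..} ?g"
    by (intro continuous_on_trop_lift continuous_on_diag_seminorm diag_seminorm_nonneg)
  have "u (\<sigma> j) \<noteq> -\<infinity>" for j
    using u by (auto simp: chart_def trop_cone_def)
  then have "a 0 = u \<circ> \<sigma>"
    by (auto simp: a_def max_absorb1)
  then have at_0: "?g 0 = u"
    using trop_lift_chart[OF u] by simp
  have "?g t \<in> chart \<sigma> \<and> finite_lift f (?g t)" if t: "0 < t" for t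
  proof -
    have fin: "a t j \<noteq> \<infinity>" for j
      using t by (auto simp: a_def max_def)
    then have "a t \<in> trop_cone"
      by (auto simp: trop_cone_def a_def)
    then have "?g t \<in> chart \<sigma>"
      by (rule trop_lift_in_chart[OF \<sigma>])
    moreover have "?g t i = \<infinity> \<longleftrightarrow> f i = 0" for i
      using diag_seminorm_eq_0_iff[OF \<sigma> fin, where w = "f i"] by (simp add: trop_lift_def)
    ultimately show ?thesis
      using chart_subset by (auto simp: finite_lift_def)
  qed
  with cont at_0 show ?thesis
    by blast
qed

end

section \<open>Quotient topologies\<close>

lemma topspace_quotient_topology [simp]:
  assumes "equiv (topspace T) R"
  shows "topspace (quotient_topology T R) = topspace T // R"
proof
  show "topspace (quotient_topology T R) \<subseteq> topspace T // R"
    using openin_topspace[of "quotient_topology T R"] unfolding openin_quotient_topology by blast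
  have "{x \<in> topspace T. R `` {x} \<in> topspace T // R} = topspace T"
    by (auto intro: quotientI)
  then have "openin (quotient_topology T R) (topspace T // R)"
    unfolding openin_quotient_topology by simp
  then show "topspace T // R \<subseteq> topspace (quotient_topology T R)"
    by (rule openin_subset)
qed

lemma quotient_map_class:
  assumes "equiv (topspace T) R"
  shows "quotient_map T (quotient_topology T R) (\<lambda>x. R `` {x})"
  unfolding quotient_map_def topspace_quotient_topology[OF assms]
  by (auto simp: openin_quotient_topology quotient_def)

abbreviation trop_class :: "('n::finite \<Rightarrow> ereal) \<Rightarrow> ('n \<Rightarrow> ereal) set" where
  "trop_class u \<equiv> trop_rel `` {u}"

lemma quotient_map_trop_class: "quotient_map (top_of_set trop_cone) TP_topology trop_class"
  unfolding TP_topology_def euclidean_product_topology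
  by (rule quotient_map_class) (simp add: equiv_trop_rel)

lemma trop_rel_imp_shift: "(u, v) \<in> trop_rel \<Longrightarrow> \<exists>c. v = (\<lambda>i. u i + ereal c)"
  unfolding trop_rel_def by (auto simp: fun_eq_iff)

lemma homothety_imp_scale: "(s, t) \<in> homothety nabs \<Longrightarrow> \<exists>c>0. \<forall>w. t w = c * s w"
  by (simp add: homothety_def)

lemma homothety_refl: "s \<in> nontrivial_seminorms nabs \<Longrightarrow> (s, s) \<in> homothety nabs"
  by (auto simp: homothety_def intro!: exI[of _ 1])

lemma equiv_homothety: "equiv (nontrivial_seminorms nabs) (homothety nabs)"
proof (rule equivI)
  show "homothety nabs \<subseteq> nontrivial_seminorms nabs \<times> nontrivial_seminorms nabs"
    by (auto simp: homothety_def)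
  show "refl_on (nontrivial_seminorms nabs) (homothety nabs)"
    by (simp add: refl_on_def homothety_refl)
  show "sym (homothety nabs)"
  proof (rule symI)
    fix s t assume "(s, t) \<in> homothety nabs"
    then obtain c where c: "s \<in> nontrivial_seminorms nabs" "t \<in> nontrivial_seminorms nabs"
      "0 < c" "\<And>w. t w = c * s w"
      by (auto simp: homothety_def)
    then have "0 < inverse c" "\<forall>w. s w = inverse c * t w"
      by auto
    with c show "(t, s) \<in> homothety nabs"
      unfolding homothety_def by blast
  qed
  show "trans (homothety nabs)"
  proof (rule transI)
    fix s t r assume st: "(s, t) \<in> homothety nabs" and tr: "(t, r) \<in> homothety nabs"
    from st obtain c where c: "s \<in> nontrivial_seminorms nabs" "0 < c" "\<And>w. t w = c * s w"
      by (auto simp: homothety_def)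
    from tr obtain d where d: "r \<in> nontrivial_seminorms nabs" "0 < d" "\<And>w. r w = d * t w"
      by (auto simp: homothety_def)
    have "0 < d * c" "\<forall>w. r w = d * c * s w"
      using c d by auto
    with c d show "(s, r) \<in> homothety nabs"
      unfolding homothety_def by blast
  qed
qed

lemma homothety_class_scale:
  assumes "s \<in> nontrivial_seminorms nabs" "t \<in> nontrivial_seminorms nabs"
    and "0 < c" "\<And>w. t w = c * s w"
  shows "homothety nabs `` {t} = homothety nabs `` {s}"
  using assms by (intro equiv_class_eq[OF equiv_homothety, symmetric]) (auto simp: homothety_def)

lemma quotient_map_homothety_class:
  "quotient_map (top_of_set (nontrivial_seminorms nabs)) (GI_topology nabs) (\<lambda>s. homothety nabs `` {s})"
  unfolding GI_topology_def euclidean_product_topology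
  by (rule quotient_map_class) (simp add: equiv_homothety)


section \<open>The retraction of the building\<close>

lemma nontrivial_seminorms_scale:
  assumes s: "s \<in> nontrivial_seminorms nabs" and c: "0 < c"
  shows "(\<lambda>w. c * s w) \<in> nontrivial_seminorms nabs"
proof -
  have "c * s (v + w) \<le> max (c * s v) (c * s w)" for v w
  proof -
    have "s (v + w) \<le> max (s v) (s w)"
      using s by (simp add: nontrivial_seminorms_def seminorm_def)
    then have "c * s (v + w) \<le> c * max (s v) (s w)"
      using c by simp
    then show ?thesis
      using c by (simp add: max_mult_distrib_left)
  qed
  then show ?thesis
    using s c by (auto simp: nontrivial_seminorms_def seminorm_def)
qed

context immersion
begin

lemma pull_seminorm:
  assumes "s \<in> nontrivial_seminorms nabs"
  shows "(\<lambda>g. s (pull_form f g)) \<in> nontrivial_seminorms nabs"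
proof -
  obtain w where w: "s w \<noteq> 0"
    using assms by (auto simp: nontrivial_seminorms_def)
  moreover obtain g where "pull_form f g = w"
    using pull_form_surj[OF f] by blast
  ultimately show ?thesis
    using assms by (auto simp: nontrivial_seminorms_def seminorm_def pull_form_add pull_form_scale)
qed

text \<open>
  The linear forms \<open>e\<^sub>i\<^sup>* \<circ> \<iota>\<close> are the \<open>f i\<close>. Both maps are unions over representatives, which all
  contribute the same class.
\<close>

lemma trop_building_map_class:
  assumes s: "s \<in> nontrivial_seminorms nabs"
  shows "trop_map (building_map nabs f (homothety nabs `` {s})) = trop_class (trop_lift f s)"
proof -
  let ?p = "\<lambda>s g. s (pull_form f g)"
  have pull: "homothety nabs `` {?p t} = homothety nabs `` {?p s}" if "(s, t) \<in> homothety nabs" for t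
  proof -
    obtain c where t: "t \<in> nontrivial_seminorms nabs" and c: "0 < c" "\<And>w. t w = c * s w"
      using \<open>(s, t) \<in> homothety nabs\<close> by (auto simp: homothety_def)
    show ?thesis
      using c by (intro homothety_class_scale[OF pull_seminorm[OF s] pull_seminorm[OF t], of c])
  qed
  have *: "building_map nabs f (homothety nabs `` {s}) = homothety nabs `` {?p s}"
    unfolding building_map_def
  proof (rule SUP_eq_const)
    show "homothety nabs `` {s} \<noteq> {}"
      using homothety_refl[OF s] by blast
  qed (rule pull, simp)
  have trop: "trop_class (\<lambda>i. neglog (t (axis i 1))) = trop_class (trop_lift f s)"
    if st: "(?p s, t) \<in> homothety nabs" for t
  proof -
    obtain c where c: "0 < c" "\<And>w. t w = c * ?p s w"
      using homothety_imp_scale[OF st] by blast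
    have "0 \<le> s (f i)" for i
      using s by (simp add: nontrivial_seminorms_def seminorm_def)
    then have "(\<lambda>i. neglog (t (axis i 1))) = (\<lambda>i. trop_lift f s i + ereal (- ln c))"
      using c by (simp add: trop_lift_def neglog_mult)
    then show ?thesis
      using trop_class_shift[OF trop_lift_in_trop_cone[OF f s]] by simp
  qed
  show ?thesis
    unfolding * trop_map_def
  proof (rule SUP_eq_const)
    show "homothety nabs `` {?p s} \<noteq> {}"
      using homothety_refl[OF pull_seminorm[OF s]] by blast
  qed (rule trop, simp)
qed

lemma continuous_map_trop_building_map:
  "continuous_map (GI_topology nabs) TP_topology (trop_map \<circ> building_map nabs f)"
proof -
  let ?X = "top_of_set (nontrivial_seminorms nabs)"
  have "continuous_on (nontrivial_seminorms nabs) (trop_lift f)"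
  proof -
    have "continuous_on (nontrivial_seminorms nabs) (\<lambda>s. s (f i))" for i
      by (rule continuous_on_subset[OF continuous_on_product_coordinates]) simp
    moreover have "0 \<le> s (f i)" if "s \<in> nontrivial_seminorms nabs" for s i
      using that by (simp add: nontrivial_seminorms_def seminorm_def)
    ultimately show ?thesis
      using continuous_on_trop_lift[of "nontrivial_seminorms nabs" "\<lambda>s. s"] by blast
  qed
  then have "continuous_map ?X (top_of_set trop_cone) (trop_lift f)"
    using trop_lift_in_trop_cone[OF f] by (auto simp: continuous_map_subtopology_eu)
  then have "continuous_map ?X TP_topology (trop_class \<circ> trop_lift f)"
    using quotient_imp_continuous_map[OF quotient_map_trop_class] by (rule continuous_map_compose)
  then have "continuous_map ?X TP_topology
      ((trop_map \<circ> building_map nabs f) \<circ> (\<lambda>s. homothety nabs `` {s}))"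
    by (rule continuous_map_eq) (simp add: trop_building_map_class)
  then show ?thesis
    by (simp only: continuous_compose_quotient_map_eq[OF quotient_map_homothety_class])
qed


section \<open>The embedding into the building\<close>

text \<open>
  The map \<open>J\<close>: the class of the largest seminorm with value at most \<open>expneg (u i)\<close> at \<open>f i\<close>, diagonalized
  in any chart that contains \<open>u\<close>. The union is taken over all representatives and all charts, which
  contribute the same class by \<open>trop_section_class\<close>.
\<close>

definition trop_section :: "('n \<Rightarrow> ereal) set \<Rightarrow> ('k^'r \<Rightarrow> real) set" where
  "trop_section p = \<Union>{diag_class nabs (f \<circ> \<sigma>) (u \<circ> \<sigma>) |\<sigma> u. u \<in> p \<and> is_basis (f \<circ> \<sigma>) \<and> u \<in> chart \<sigma>}"

lemma chart_seminorm_nontrivial: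
  "is_basis (f \<circ> \<sigma>) \<Longrightarrow> u \<in> chart \<sigma> \<Longrightarrow>
    diag_seminorm nabs (f \<circ> \<sigma>) (u \<circ> \<sigma>) \<in> nontrivial_seminorms nabs"
  by (intro diag_seminorm_in_nontrivial chart_restrict)

text \<open>
  Another representative of the point scales the seminorm by a constant, and another chart gives the
  same seminorm.
\<close>

lemma trop_section_class:
  assumes \<sigma>: "is_basis (f \<circ> \<sigma>)" "u \<in> chart \<sigma>"
  shows "trop_section (trop_class u) = diag_class nabs (f \<circ> \<sigma>) (u \<circ> \<sigma>)"
proof -
  have "diag_class nabs (f \<circ> \<tau>) (v \<circ> \<tau>) = diag_class nabs (f \<circ> \<sigma>) (u \<circ> \<sigma>)"
    if v: "(u, v) \<in> trop_rel" and \<tau>: "is_basis (f \<circ> \<tau>)" "v \<in> chart \<tau>" for v \<tau>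
  proof -
    obtain c where v_eq: "v = (\<lambda>i. u i + ereal c)"
      using trop_rel_imp_shift[OF v] by blast
    then have v\<sigma>: "v \<in> chart \<sigma>"
      using chart_shift(1)[OF \<sigma>(2)] by simp
    have "diag_class nabs (f \<circ> \<tau>) (v \<circ> \<tau>) = diag_class nabs (f \<circ> \<sigma>) (v \<circ> \<sigma>)"
      unfolding diag_class_def using chart_agree[OF \<tau> \<sigma>(1) v\<sigma>] by simp
    also have "\<dots> = diag_class nabs (f \<circ> \<sigma>) (u \<circ> \<sigma>)"
      unfolding diag_class_def
      by (rule homothety_class_scale[of _ _ _ "exp (- c)"])
        (use \<sigma> v\<sigma> chart_shift(2)[OF \<sigma>(2), of c] in \<open>simp_all add: chart_seminorm_nontrivial v_eq\<close>)
    finally show ?thesis .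
  qed
  moreover have "(u, u) \<in> trop_rel"
    using \<sigma>(2) chart_subset equiv_class_self[OF equiv_trop_rel] by blast
  ultimately show ?thesis
    unfolding trop_section_def using \<sigma> by (intro equalityI subsetI) blast+
qed

definition chart_image :: "('r \<Rightarrow> 'n) \<Rightarrow> ('n \<Rightarrow> ereal) set set" where
  "chart_image \<sigma> = trop_class ` chart \<sigma>"

lemma trop_class_in_chart_image_iff:
  assumes "u \<in> trop_cone"
  shows "trop_class u \<in> chart_image \<sigma> \<longleftrightarrow> u \<in> chart \<sigma>"
proof
  assume "trop_class u \<in> chart_image \<sigma>"
  then obtain v where v: "v \<in> chart \<sigma>" "trop_class v = trop_class u"
    by (auto simp: chart_image_def)
  then have "(v, u) \<in> trop_rel"
    using eq_equiv_class[OF _ equiv_trop_rel assms] by blast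
  then obtain c where "u = (\<lambda>i. v i + ereal c)"
    using trop_rel_imp_shift by blast
  then show "u \<in> chart \<sigma>"
    using chart_shift(1)[OF v(1)] by simp
qed (simp add: chart_image_def)

lemma chart_in_Trop: "is_basis (f \<circ> \<sigma>) \<Longrightarrow> u \<in> chart \<sigma> \<Longrightarrow> trop_class u \<in> Trop nabs f"
  using diag_seminorm_in_Trop[OF f, of "f \<circ> \<sigma>" "u \<circ> \<sigma>"] by (simp add: chart_restrict trop_lift_chart)

text \<open>
  Seminorms from the analytification lie in some chart, and the diagonal seminorms of a chart extend to
  Gauss norms.
\<close>

lemma Trop_eq: "Trop nabs f = (\<Union>\<sigma>\<in>{\<sigma>. is_basis (f \<circ> \<sigma>)}. chart_image \<sigma>)"
proof
  show "Trop nabs f \<subseteq> (\<Union>\<sigma>\<in>{\<sigma>. is_basis (f \<circ> \<sigma>)}. chart_image \<sigma>)"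
  proof
    fix p assume "p \<in> Trop nabs f"
    then obtain s where "s \<in> nontrivial_seminorms nabs" "p = trop_class (trop_lift f s)"
      using Trop_imp_seminorm[OF f] by blast
    moreover then obtain \<sigma> where "is_basis (f \<circ> \<sigma>)" "trop_lift f s \<in> chart \<sigma>"
      using trop_lift_in_some_chart by blast
    ultimately show "p \<in> (\<Union>\<sigma>\<in>{\<sigma>. is_basis (f \<circ> \<sigma>)}. chart_image \<sigma>)"
      by (auto simp: chart_image_def)
  qed
qed (auto simp: chart_image_def chart_in_Trop)

lemma Trop_cases:
  assumes "p \<in> Trop nabs f"
  obtains \<sigma> u where "is_basis (f \<circ> \<sigma>)" "u \<in> chart \<sigma>" "p = trop_class u"
  using assms by (auto simp: Trop_eq chart_image_def)

lemma trop_building_map_section: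
  assumes "p \<in> Trop nabs f"
  shows "trop_map (building_map nabs f (trop_section p)) = p"
proof -
  obtain \<sigma> u where "is_basis (f \<circ> \<sigma>)" "u \<in> chart \<sigma>" "p = trop_class u"
    using Trop_cases[OF assms] by blast
  then show ?thesis
    by (simp add: trop_section_class diag_class_def trop_building_map_class chart_seminorm_nontrivial
        trop_lift_chart)
qed

lemma preimage_chart_image: "{u \<in> topspace (top_of_set trop_cone). trop_class u \<in> chart_image \<sigma>} = chart \<sigma>"
  using trop_class_in_chart_image_iff chart_subset by auto

lemma closedin_chart_image: "closedin TP_topology (chart_image \<sigma>)"
proof -
  have "chart_image \<sigma> \<subseteq> topspace TP_topology"
    using quotient_imp_surjective_map[OF quotient_map_trop_class] chart_subset
    by (auto simp: chart_image_def)
  moreover have "closedin (top_of_set trop_cone)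
      {u \<in> topspace (top_of_set trop_cone). trop_class u \<in> chart_image \<sigma>}"
    unfolding preimage_chart_image by (rule closedin_chart)
  ultimately show ?thesis
    using quotient_map_trop_class unfolding quotient_map_closedin by blast
qed

lemma Trop_subset: "Trop nabs f \<subseteq> topspace TP_topology"
  using closedin_chart_image closedin_subset unfolding Trop_eq by blast

lemma topspace_Trop_topology: "topspace (Trop_topology nabs f) = Trop nabs f"
  using Trop_subset by (auto simp: Trop_topology_def)

lemma subtopology_chart_image:
  "is_basis (f \<circ> \<sigma>) \<Longrightarrow>
    subtopology (Trop_topology nabs f) (chart_image \<sigma>) = subtopology TP_topology (chart_image \<sigma>)"
  unfolding Trop_topology_def subtopology_subtopology
  by (rule arg_cong[of _ _ "subtopology TP_topology"]) (auto simp: Trop_eq)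

lemma closedin_Trop_chart_image:
  "is_basis (f \<circ> \<sigma>) \<Longrightarrow> closedin (Trop_topology nabs f) (chart_image \<sigma>)"
  unfolding Trop_topology_def
  by (rule closedin_subset_topspace[OF closedin_chart_image]) (auto simp: Trop_eq)

lemma continuous_map_trop_section_chart:
  assumes \<sigma>: "is_basis (f \<circ> \<sigma>)"
  shows "continuous_map (subtopology TP_topology (chart_image \<sigma>)) (GI_topology nabs) trop_section"
proof -
  have quo: "quotient_map (subtopology (top_of_set trop_cone) (chart \<sigma>))
      (subtopology TP_topology (chart_image \<sigma>)) trop_class"
    by (rule quotient_map_restriction[OF quotient_map_trop_class preimage_chart_image])
      (simp add: closedin_chart_image)
  have top: "subtopology (top_of_set trop_cone) (chart \<sigma>) = top_of_set (chart \<sigma>)"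
    using chart_subset[of \<sigma>] by (simp add: subtopology_subtopology inf.absorb2)
  let ?d = "\<lambda>u. diag_seminorm nabs (f \<circ> \<sigma>) (u \<circ> \<sigma>)"
  have "continuous_on (chart \<sigma>) ?d"
  proof (rule continuous_on_coordinatewise_then_product, rule continuous_on_diag_seminorm)
    show "continuous_on (chart \<sigma>) (\<lambda>u. expneg ((u \<circ> \<sigma>) j))" for j
      using continuous_on_subset[OF continuous_on_expneg_coordinate chart_subset] by simp
  qed
  then have "continuous_map (top_of_set (chart \<sigma>)) (top_of_set (nontrivial_seminorms nabs)) ?d"
    using chart_seminorm_nontrivial[OF \<sigma>] by (auto simp: continuous_map_subtopology_eu)
  then have "continuous_map (top_of_set (chart \<sigma>)) (GI_topology nabs)
      ((\<lambda>s. homothety nabs `` {s}) \<circ> ?d)"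
    using quotient_imp_continuous_map[OF quotient_map_homothety_class] by (rule continuous_map_compose)
  then have "continuous_map (top_of_set (chart \<sigma>)) (GI_topology nabs) (trop_section \<circ> trop_class)"
    by (rule continuous_map_eq) (simp add: trop_section_class[OF \<sigma>] diag_class_def)
  then show ?thesis
    by (rule continuous_compose_quotient_map_eq[OF quo[unfolded top], THEN iffD1])
qed

lemma trop_section_in_apartment:
  assumes "is_basis (f \<circ> \<sigma>)" "p \<in> chart_image \<sigma>"
  shows "trop_section p \<in> apartment nabs (f \<circ> \<sigma>)"
  using assms by (auto simp: chart_image_def apartment_def trop_section_class chart_restrict)

text \<open>
  The finitely many chart images are closed, so continuity on each of them is enough.
\<close>

lemma continuous_map_trop_section: "continuous_map (Trop_topology nabs f) (building_topology nabs) trop_section"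
proof -
  have "continuous_map (Trop_topology nabs f) (GI_topology nabs) trop_section"
  proof (rule pasting_lemma_closed[where I = "{\<sigma>. is_basis (f \<circ> \<sigma>)}" and T = chart_image and f = "\<lambda>_. trop_section"])
    show "continuous_map (subtopology (Trop_topology nabs f) (chart_image \<sigma>)) (GI_topology nabs) trop_section"
      if "\<sigma> \<in> {\<sigma>. is_basis (f \<circ> \<sigma>)}" for \<sigma>
      using that by (simp add: subtopology_chart_image continuous_map_trop_section_chart)
  qed (auto simp: closedin_Trop_chart_image topspace_Trop_topology Trop_eq)
  moreover have "trop_section p \<in> building nabs" if "p \<in> Trop nabs f" for p
    using that trop_section_in_apartment unfolding Trop_eq building_def by blast
  ultimately show ?thesis
    by (auto simp: building_topology_def continuous_map_in_subtopology topspace_Trop_topology)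
qed

text \<open>
  \<open>trop \<circ> B(\<iota>)\<close> maps the whole building to the tropicalization, so \<open>trop_section\<close> is a section of a
  continuous map.
\<close>

lemma embedding_map_trop_section: "embedding_map (Trop_topology nabs f) (building_topology nabs) trop_section"
proof (rule section_imp_embedding_map)
  have "trop_map (building_map nabs f C) \<in> Trop nabs f" if C: "C \<in> building nabs" for C
  proof -
    obtain e a where e: "is_basis e" and a: "a \<in> trop_cone" and "C = diag_class nabs e a"
      using C by (auto simp: building_def apartment_def)
    then show ?thesis
      using trop_building_map_class[OF diag_seminorm_in_nontrivial[OF e a]] diag_seminorm_in_Trop[OF f e a]
      by (simp add: diag_class_def)
  qed
  moreover have "continuous_map (building_topology nabs) TP_topology (trop_map \<circ> building_map nabs f)"
    unfolding building_topology_def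
    by (rule continuous_map_from_subtopology[OF continuous_map_trop_building_map])
  moreover have "topspace (building_topology nabs) \<subseteq> building nabs"
    by (auto simp: building_topology_def)
  ultimately have "continuous_map (building_topology nabs) (Trop_topology nabs f)
      (trop_map \<circ> building_map nabs f)"
    by (auto simp: Trop_topology_def continuous_map_in_subtopology)
  then show "section_map (Trop_topology nabs f) (building_topology nabs) trop_section"
    unfolding section_map_def retraction_maps_def
    using continuous_map_trop_section trop_building_map_section
    by (intro exI[of _ "trop_map \<circ> building_map nabs f"]) (auto simp: topspace_Trop_topology)
qed


section \<open>Piecewise linearity\<close>

text \<open>
  Selecting all cells that lie in the chart makes the closure under smaller cells automatic.
\<close>

definition chart_complex :: "('r \<Rightarrow> 'n) \<Rightarrow> ('n \<Rightarrow> ereal) set set set" where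
  "chart_complex \<sigma> = {C \<in> cells nabs f. C \<subseteq> chart_image \<sigma>}"

lemma is_subcomplex_chart_complex: "is_subcomplex nabs f (chart_complex \<sigma>)"
  by (auto simp: is_subcomplex_def chart_complex_def)

text \<open>
  The open cell of the point consists of points with the same initial matroid. This matroid
  contains the range of \<open>\<sigma>\<close>, so the whole open cell lies in the chart, and with it the closure.
\<close>

lemma finite_chart_point_in_complex:
  assumes \<sigma>: "is_basis (f \<circ> \<sigma>)" and u: "u \<in> chart \<sigma>" "finite_lift f u"
  shows "trop_class u \<in> \<Union>(chart_complex \<sigma>)"
proof -
  let ?M = "initial_matroid nabs f u"
  let ?C = "Trop_topology nabs f closure_of open_cell nabs f ?M"
  have mem: "trop_class u \<in> open_cell nabs f ?M"
    using u chart_in_Trop[OF \<sigma>] by (auto simp: open_cell_def)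
  have "open_cell nabs f ?M \<subseteq> chart_image \<sigma>"
  proof
    fix p assume "p \<in> open_cell nabs f ?M"
    then obtain v where v: "p = trop_class v" "finite_lift f v" "trop_class v \<in> Trop nabs f"
      "initial_matroid nabs f v = ?M"
      by (auto simp: open_cell_def)
    obtain s where s: "s \<in> nontrivial_seminorms nabs" "trop_class v = trop_class (trop_lift f s)"
      using Trop_imp_seminorm[OF f v(3)] by blast
    have "(trop_lift f s, v) \<in> trop_rel"
      using eq_equiv_class[OF s(2)[symmetric] equiv_trop_rel] v(2) by (simp add: finite_lift_def)
    then obtain c where "v = (\<lambda>i. trop_lift f s i + ereal c)"
      using trop_rel_imp_shift by blast
    moreover have "neglog (exp (- c) * s (f i)) = neglog (s (f i)) + ereal c" for i
      using s(1) by (simp add: neglog_mult nontrivial_seminorms_def seminorm_def)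
    ultimately have v_eq: "v = trop_lift f (\<lambda>w. exp (- c) * s w)"
      by (auto simp: trop_lift_def)
    have "(\<lambda>w. exp (- c) * s w) \<in> nontrivial_seminorms nabs"
      by (rule nontrivial_seminorms_scale[OF s(1)]) simp
    moreover have "range \<sigma> \<in> initial_matroid nabs f v"
      unfolding v(4) by (rule chart_imp_initial_matroid[OF u(2) \<sigma> u(1)])
    moreover have "inj \<sigma>"
      using basis_candidate[OF \<sigma>] by (simp add: candidates_def)
    ultimately have "v \<in> chart \<sigma>"
      using initial_matroid_imp_chart(2)[of "\<lambda>w. exp (- c) * s w" \<sigma>] v(2) unfolding v_eq by blast
    then show "p \<in> chart_image \<sigma>"
      by (simp add: v(1) chart_image_def)
  qed
  then have "?C \<subseteq> chart_image \<sigma>"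
    by (rule closure_of_minimal[OF _ closedin_Trop_chart_image[OF \<sigma>]])
  moreover have "?C \<in> cells nabs f"
    using mem by (auto simp: cells_def)
  moreover have "trop_class u \<in> ?C"
    using mem closure_of_subset[of "open_cell nabs f ?M" "Trop_topology nabs f"]
    by (auto simp: topspace_Trop_topology open_cell_def)
  ultimately show ?thesis
    by (auto simp: chart_complex_def)
qed

text \<open>
  The finite points of the chart are covered, and every other point is a limit of these. The cells
  are finite in number, so their union is closed.
\<close>

lemma Union_chart_complex:
  assumes \<sigma>: "is_basis (f \<circ> \<sigma>)"
  shows "\<Union>(chart_complex \<sigma>) = chart_image \<sigma>"
proof
  show "\<Union>(chart_complex \<sigma>) \<subseteq> chart_image \<sigma>"
    by (auto simp: chart_complex_def)
  have "finite (cells nabs f)"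
    unfolding cells_def by (simp add: finite_image_set)
  then have "finite (chart_complex \<sigma>)"
    by (simp add: chart_complex_def)
  then have closed: "closedin (Trop_topology nabs f) (\<Union>(chart_complex \<sigma>))"
    by (rule closedin_Union) (auto simp: chart_complex_def cells_def)
  then obtain D where D: "closedin TP_topology D" "\<Union>(chart_complex \<sigma>) = D \<inter> Trop nabs f"
    by (auto simp: Trop_topology_def closedin_subtopology)
  then have preimage: "closedin (top_of_set trop_cone) {u \<in> topspace (top_of_set trop_cone). trop_class u \<in> D}"
    using quotient_map_trop_class closedin_subset[OF D(1)] unfolding quotient_map_closedin by blast
  show "chart_image \<sigma> \<subseteq> \<Union>(chart_complex \<sigma>)"
  proof
    fix p assume "p \<in> chart_image \<sigma>"
    then obtain u where u: "u \<in> chart \<sigma>" "p = trop_class u"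
      by (auto simp: chart_image_def)
    obtain g where "continuous_on {0..} g \<and> g (0 :: real) = u \<and>
        (\<forall>t>0. g t \<in> chart \<sigma> \<and> finite_lift f (g t))"
      using chart_approximation[OF \<sigma> u(1)] ..
    then have g: "continuous_on {0..} g" "g 0 = u"
      "\<And>t. 0 < t \<Longrightarrow> g t \<in> chart \<sigma> \<and> finite_lift f (g t)"
      by simp_all
    have "g 0 \<in> {u \<in> topspace (top_of_set trop_cone). trop_class u \<in> D}"
    proof (rule closedin_trop_cone_limit[OF preimage g(1)])
      show "g t \<in> {u \<in> topspace (top_of_set trop_cone). trop_class u \<in> D}" if "0 < t" for t
        using g(3)[OF that] finite_chart_point_in_complex[OF \<sigma>, of "g t"] D(2) chart_subset by auto
    qed (use g(2) u chart_subset in auto)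
    then show "p \<in> \<Union>(chart_complex \<sigma>)"
      unfolding D(2) using g(2) u chart_in_Trop[OF \<sigma>] by auto
  qed
qed

text \<open>
  On the chart, \<open>x i\<close> is the minimum of \<open>val c\<^sub>i\<^sub>j + x (\<sigma> j)\<close>, where \<open>c\<^sub>i\<^sub>j\<close> are the coordinates of \<open>f i\<close>.
  The function \<open>\<beta>\<close> selects for each \<open>i\<close> an index at which the minimum is attained; fixing it turns the
  condition into linear equations and inequalities. Vanishing coordinates, of infinite valuation, impose
  no condition and cannot attain the minimum.
\<close>

definition chart_polyhedron :: "('r \<Rightarrow> 'n) \<Rightarrow> ('n \<Rightarrow> 'r) \<Rightarrow> (real^'n) set" where
  "chart_polyhedron \<sigma> \<beta> = {x. \<forall>i. if f i = 0 then x $ i = 0 else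
     (let val = (\<lambda>j. - ln (nabs (coord (f \<circ> \<sigma>) (f i) j))) in
       coord (f \<circ> \<sigma>) (f i) (\<beta> i) \<noteq> 0 \<and> x $ i - x $ \<sigma> (\<beta> i) = val (\<beta> i) \<and>
       (\<forall>j. coord (f \<circ> \<sigma>) (f i) j \<noteq> 0 \<longrightarrow> x $ i - x $ \<sigma> j \<le> val j))}"

lemma polyhedron_coordinate_difference_le: "polyhedron {x :: real^'n. x $ i - x $ j \<le> c}"
  using polyhedron_halfspace_le[of "axis i 1 - axis j 1 :: real^'n" c]
  by (simp add: inner_diff_left inner_axis')

lemma polyhedron_coordinate_difference_eq: "polyhedron {x :: real^'n. x $ i - x $ j = c}"
  using polyhedron_hyperplane[of "axis i 1 - axis j 1 :: real^'n" c]
  by (simp add: inner_diff_left inner_axis')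

lemma polyhedron_coordinate_eq: "polyhedron {x :: real^'n. x $ i = c}"
  using polyhedron_hyperplane[of "axis i 1 :: real^'n" c] by (simp add: inner_axis')

lemma polyhedron_Collect_all:
  fixes P :: "'i::finite \<Rightarrow> 'a::euclidean_space \<Rightarrow> bool"
  assumes "\<And>i. polyhedron {x. P i x}"
  shows "polyhedron {x. \<forall>i. P i x}"
proof -
  have "polyhedron (\<Inter>(range (\<lambda>i. {x. P i x})))"
    using assms by (intro polyhedron_Inter) auto
  also have "\<Inter>(range (\<lambda>i. {x. P i x})) = {x. \<forall>i. P i x}"
    by auto
  finally show ?thesis .
qed

lemma polyhedron_Collect_conj:
  "polyhedron {x. P x} \<Longrightarrow> polyhedron {x. Q x} \<Longrightarrow> polyhedron {x. P x \<and> Q x}"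
  using polyhedron_Int by (simp add: Collect_conj_eq)

lemma polyhedron_chart_polyhedron: "polyhedron (chart_polyhedron \<sigma> \<beta>)"
proof -
  have const: "polyhedron {x :: real^'n. Q}" for Q
    by (cases Q) auto
  have imp: "polyhedron {x :: real^'n. Q \<longrightarrow> P x}" if "polyhedron {x. P x}" for P Q
    using that by (cases Q) auto
  show ?thesis
    unfolding chart_polyhedron_def Let_def
  proof (rule polyhedron_Collect_all)
    fix i
    show "polyhedron {x :: real^'n. if f i = 0 then x $ i = 0 else
       coord (f \<circ> \<sigma>) (f i) (\<beta> i) \<noteq> 0 \<and>
       x $ i - x $ \<sigma> (\<beta> i) = - ln (nabs (coord (f \<circ> \<sigma>) (f i) (\<beta> i))) \<and>
       (\<forall>j. coord (f \<circ> \<sigma>) (f i) j \<noteq> 0 \<longrightarrow>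
         x $ i - x $ \<sigma> j \<le> - ln (nabs (coord (f \<circ> \<sigma>) (f i) j)))}"
    proof (cases "f i = 0")
      case True
      show ?thesis
        unfolding if_P[OF True] by (rule polyhedron_coordinate_eq)
    next
      case False
      show ?thesis
        unfolding if_not_P[OF False]
        by (intro polyhedron_Collect_conj polyhedron_Collect_all const imp
            polyhedron_coordinate_difference_eq polyhedron_coordinate_difference_le)
    qed
  qed
qed

lemma chart_iff_polyhedron:
  assumes \<sigma>: "is_basis (f \<circ> \<sigma>)" and u: "finite_lift f u"
  shows "u \<in> chart \<sigma> \<longleftrightarrow> (\<exists>\<beta>. real_part u \<in> chart_polyhedron \<sigma> \<beta>)"
proof -
  let ?c = "\<lambda>i. coord (f \<circ> \<sigma>) (f i)" and ?x = "\<lambda>i. real_part u $ i"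
  have ux: "u i = ereal (?x i)" if "f i \<noteq> 0" for i
    using that u unfolding finite_lift_def trop_cone_def real_part_def by (cases "u i") auto
  have u\<sigma>: "expneg (u (\<sigma> j)) = exp (- ?x (\<sigma> j))" for j
    using ux[of "\<sigma> j"] basis_nonzero[OF \<sigma>, of j] by simp
  have term_le: "nabs (?c i j) * expneg (u (\<sigma> j)) \<le> expneg (u i)
      \<longleftrightarrow> (?c i j \<noteq> 0 \<longrightarrow> ?x i - ?x (\<sigma> j) \<le> - ln (nabs (?c i j)))"
    and term_eq: "nabs (?c i j) * expneg (u (\<sigma> j)) = expneg (u i)
      \<longleftrightarrow> ?c i j \<noteq> 0 \<and> ?x i - ?x (\<sigma> j) = - ln (nabs (?c i j))"
    if "f i \<noteq> 0" for i j
  proof -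
    have "nabs (?c i j) * expneg (u (\<sigma> j)) = exp (ln (nabs (?c i j)) - ?x (\<sigma> j))" if "?c i j \<noteq> 0"
      using that nabs_nonneg[of "?c i j"] by (simp add: u\<sigma> exp_diff exp_minus field_simps less_le)
    then show "nabs (?c i j) * expneg (u (\<sigma> j)) \<le> expneg (u i)
        \<longleftrightarrow> (?c i j \<noteq> 0 \<longrightarrow> ?x i - ?x (\<sigma> j) \<le> - ln (nabs (?c i j)))"
      and "nabs (?c i j) * expneg (u (\<sigma> j)) = expneg (u i)
        \<longleftrightarrow> ?c i j \<noteq> 0 \<and> ?x i - ?x (\<sigma> j) = - ln (nabs (?c i j))"
      using ux[OF that] by (cases "?c i j = 0"; auto)+
  qed
  have diag_eq: "expneg (u i) = diag_seminorm nabs (f \<circ> \<sigma>) (u \<circ> \<sigma>) (f i)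
      \<longleftrightarrow> (\<forall>j. nabs (?c i j) * expneg (u (\<sigma> j)) \<le> expneg (u i)) \<and>
        (\<exists>j. nabs (?c i j) * expneg (u (\<sigma> j)) = expneg (u i))" for i
    using diag_seminorm_attained[of nabs "f \<circ> \<sigma>" "u \<circ> \<sigma>" "f i"]
      diag_seminorm_le_iff[of nabs "f \<circ> \<sigma>" "u \<circ> \<sigma>" "f i" "expneg (u i)"]
      le_diag_seminorm[of nabs "f \<circ> \<sigma>" "f i" _ "u \<circ> \<sigma>"]
    by (metis antisym comp_apply order_refl)
  have zero: "expneg (u i) = diag_seminorm nabs (f \<circ> \<sigma>) (u \<circ> \<sigma>) (f i)" "?x i = 0" if "f i = 0" for i
  proof -
    have "u i = \<infinity>"
      using that u by (simp add: finite_lift_def)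
    then show "expneg (u i) = diag_seminorm nabs (f \<circ> \<sigma>) (u \<circ> \<sigma>) (f i)" "?x i = 0"
      using that seminorm_0[OF seminorm_diag_seminorm[OF \<sigma>]] by (simp_all add: real_part_def)
  qed
  have polyhedron_iff: "real_part u \<in> chart_polyhedron \<sigma> \<beta> \<longleftrightarrow> (\<forall>i. f i \<noteq> 0 \<longrightarrow>
      (\<forall>j. nabs (?c i j) * expneg (u (\<sigma> j)) \<le> expneg (u i)) \<and>
      nabs (?c i (\<beta> i)) * expneg (u (\<sigma> (\<beta> i))) = expneg (u i))" for \<beta>
    unfolding chart_polyhedron_def Let_def mem_Collect_eq
  proof (rule all_cong1)
    fix i
    show "(if f i = 0 then ?x i = 0 else ?c i (\<beta> i) \<noteq> 0 \<and>
        ?x i - ?x (\<sigma> (\<beta> i)) = - ln (nabs (?c i (\<beta> i))) \<and>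
        (\<forall>j. ?c i j \<noteq> 0 \<longrightarrow> ?x i - ?x (\<sigma> j) \<le> - ln (nabs (?c i j))))
      \<longleftrightarrow> (f i \<noteq> 0 \<longrightarrow> (\<forall>j. nabs (?c i j) * expneg (u (\<sigma> j)) \<le> expneg (u i)) \<and>
        nabs (?c i (\<beta> i)) * expneg (u (\<sigma> (\<beta> i))) = expneg (u i))"
      using zero(2) term_le term_eq by (cases "f i = 0"; simp) blast
  qed
  have "u \<in> chart \<sigma> \<longleftrightarrow>
      (\<forall>i. f i \<noteq> 0 \<longrightarrow> expneg (u i) = diag_seminorm nabs (f \<circ> \<sigma>) (u \<circ> \<sigma>) (f i))"
    using u zero(1) unfolding chart_def finite_lift_def by blast
  also have "\<dots> \<longleftrightarrow> (\<forall>i. f i \<noteq> 0 \<longrightarrow>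
      (\<forall>j. nabs (?c i j) * expneg (u (\<sigma> j)) \<le> expneg (u i)) \<and>
      (\<exists>j. nabs (?c i j) * expneg (u (\<sigma> j)) = expneg (u i)))"
    unfolding diag_eq ..
  also have "\<dots> \<longleftrightarrow> (\<exists>\<beta>. \<forall>i. f i \<noteq> 0 \<longrightarrow>
      (\<forall>j. nabs (?c i j) * expneg (u (\<sigma> j)) \<le> expneg (u i)) \<and>
      nabs (?c i (\<beta> i)) * expneg (u (\<sigma> (\<beta> i))) = expneg (u i))"
    by metis
  also have "\<dots> \<longleftrightarrow> (\<exists>\<beta>. real_part u \<in> chart_polyhedron \<sigma> \<beta>)"
    by (simp only: polyhedron_iff)
  finally show ?thesis .
qed

lemma finite_support_chart_image:
  assumes \<sigma>: "is_basis (f \<circ> \<sigma>)"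
  shows "finite_support f (chart_image \<sigma>) = (\<Union>\<beta>. chart_polyhedron \<sigma> \<beta>)"
proof
  show "finite_support f (chart_image \<sigma>) \<subseteq> (\<Union>\<beta>. chart_polyhedron \<sigma> \<beta>)"
  proof
    fix x assume "x \<in> finite_support f (chart_image \<sigma>)"
    then obtain u where "x = real_part u" "finite_lift f u" "trop_class u \<in> chart_image \<sigma>"
      by (auto simp: finite_support_def)
    then show "x \<in> (\<Union>\<beta>. chart_polyhedron \<sigma> \<beta>)"
      using chart_iff_polyhedron[OF \<sigma>] trop_class_in_chart_image_iff
      by (auto simp: finite_lift_def)
  qed
  show "(\<Union>\<beta>. chart_polyhedron \<sigma> \<beta>) \<subseteq> finite_support f (chart_image \<sigma>)"
  proof
    fix x assume x: "x \<in> (\<Union>\<beta>. chart_polyhedron \<sigma> \<beta>)"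
    define u where "u = (\<lambda>i. if f i = 0 then \<infinity> else ereal (x $ i))"
    have "f (\<sigma> j) \<noteq> 0" for j
      using basis_nonzero[OF \<sigma>, of j] by simp
    then have u: "finite_lift f u"
      by (auto simp: u_def finite_lift_def trop_cone_def)
    have "x = real_part u"
      using x by (auto simp: vec_eq_iff real_part_def u_def chart_polyhedron_def split: if_splits)
    moreover have "u \<in> chart \<sigma>"
      using x chart_iff_polyhedron[OF \<sigma> u] \<open>x = real_part u\<close> by auto
    ultimately show "x \<in> finite_support f (chart_image \<sigma>)"
      using u by (auto simp: finite_support_def chart_image_def)
  qed
qed

text \<open>
  In the coordinates of the apartment of \<open>f \<circ> \<sigma>\<close>, the map is the projection to the coordinates at
  \<open>\<sigma>\<close>, so the same linear map serves on all polyhedra.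
\<close>

lemma piecewise_linear_on_trop_section:
  assumes \<sigma>: "is_basis (f \<circ> \<sigma>)"
  shows "piecewise_linear_on nabs f (f \<circ> \<sigma>) (chart_image \<sigma>) trop_section"
  unfolding piecewise_linear_on_def
proof (intro exI[of _ "range (chart_polyhedron \<sigma>)"] conjI ballI)
  show "finite_support f (chart_image \<sigma>) = \<Union>(range (chart_polyhedron \<sigma>))"
    by (simp add: finite_support_chart_image[OF \<sigma>])
  fix P assume P: "P \<in> range (chart_polyhedron \<sigma>)"
  then show "polyhedron P"
    using polyhedron_chart_polyhedron by auto
  let ?A = "(\<chi> j i. if i = \<sigma> j then 1 else 0) :: real^'n^'r"
  show "\<exists>(A :: real^'n^'r) b. \<forall>u. finite_lift f u \<longrightarrow> real_part u \<in> P \<longrightarrow>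
      trop_section (trop_class u) = diag_class nabs (f \<circ> \<sigma>) (\<lambda>i. ereal ((A *v real_part u + b) $ i))"
  proof (intro exI[of _ ?A] exI[of _ 0] allI impI)
    fix u assume u: "finite_lift f u" "real_part u \<in> P"
    then have "u \<in> chart \<sigma>"
      using chart_iff_polyhedron[OF \<sigma> u(1)] P by auto
    moreover have "u (\<sigma> j) = ereal ((?A *v real_part u + 0) $ j)" for j
    proof -
      have "(?A *v real_part u) $ j = real_part u $ \<sigma> j"
        by (simp add: matrix_vector_mult_def if_distrib[of "\<lambda>x. x * _"] cong: if_cong)
      moreover have "\<bar>u (\<sigma> j)\<bar> \<noteq> \<infinity>"
        using u(1) basis_nonzero[OF \<sigma>, of j] by (auto simp: finite_lift_def trop_cone_def)
      ultimately show ?thesis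
        by (simp add: real_part_def ereal_real)
    qed
    ultimately show "trop_section (trop_class u)
        = diag_class nabs (f \<circ> \<sigma>) (\<lambda>i. ereal ((?A *v real_part u + 0) $ i))"
      using trop_section_class[OF \<sigma>] by (simp add: o_def)
  qed
qed simp

lemma piecewise_linear_embedding_trop_section: "piecewise_linear_embedding nabs f trop_section"
  unfolding piecewise_linear_embedding_def
proof (intro conjI embedding_map_trop_section exI[of _ "chart_complex ` {\<sigma>. is_basis (f \<circ> \<sigma>)}"] ballI)
  show "(\<Union>\<C>\<in>chart_complex ` {\<sigma>. is_basis (f \<circ> \<sigma>)}. \<Union>\<C>) = Trop nabs f"
    by (simp add: Trop_eq Union_chart_complex)
  fix \<C> assume "\<C> \<in> chart_complex ` {\<sigma>. is_basis (f \<circ> \<sigma>)}"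
  then obtain \<sigma> where \<sigma>: "is_basis (f \<circ> \<sigma>)" "\<C> = chart_complex \<sigma>"
    by blast
  then show "is_subcomplex nabs f \<C>"
    by (simp add: is_subcomplex_chart_complex)
  show "\<exists>e. is_basis e \<and> trop_section ` \<Union>\<C> \<subseteq> apartment nabs e \<and> piecewise_linear_on nabs f e (\<Union>\<C>) trop_section"
    using \<sigma> trop_section_in_apartment piecewise_linear_on_trop_section
    by (intro exI[of _ "f \<circ> \<sigma>"]) (auto simp: Union_chart_complex)
qed simp

end

theorem theorem0p2:
  fixes nabs :: "'k::field \<Rightarrow> real"
    and f :: "'n::finite \<Rightarrow> 'k^'r::finite"
  assumes "complete_nonarch_field nabs"
    and "linear_immersion f"
  shows "\<exists>J. piecewise_linear_embedding nabs f J \<and>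
           (\<forall>p\<in>Trop nabs f. (trop_map \<circ> building_map nabs f \<circ> J) p = p)"
proof -
  interpret immersion nabs f
    using assms nonarch_if_complete_nonarch_field by (simp add: immersion_def immersion_axioms_def)
  show ?thesis
    using piecewise_linear_embedding_trop_section trop_building_map_section by auto
qed

end
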